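(* There exists an absolute constant $C>0$ such that, for every $n\ge 1$, every convex body $K\subseteq\mathbb{R}^n$ and every $x\in\operatorname{int}(K)$, $$\frac12\,e^{\Lambda_K^*(x)}\ \leq\ N_K(x)\ \leq\ C\,n^{3/2}e^{\Lambda_K^*(x)}.$$
   Context: A convex body in $\mathbb{R}^n$ is a compact convex set with non-empty interior; $\mu_K$ is the uniform probability measure on $K$. For a Borel probability measure $\mu$ on $\mathbb{R}^n$, $\Lambda_\mu(\theta)=\log\int_{\mathbb{R}^n}e^{\langle\theta,x\rangle}\,d\mu(x)$ and the Cramér transform is $\Lambda_\mu^*(x)=\sup_{\theta\in\mathbb{R}^n}\{\langle\theta,x\rangle-\Lambda_\mu(\theta)\}$; write $\Lambda_K^*=\Lambda_{\mu_K}^*$. If $X_1,X_2,\ldots$ are independent random vectors with law $\mu$, define the median sampling threshold $N_\mu(x)=\inf\{N\in\mathbb{N}:\mathbb{P}(x\in\operatorname{conv}\{X_1,\ldots,X_N\})\geq\frac12\}$, and write $N_K=N_{\mu_K}$. *)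

theory Defs
  imports "HOL-Probability.Probability"
begin

text \<open>
  The constant in the theorem does not depend on the dimension, so the dimension has to be an
  ordinary natural number and cannot be a type. The space \<open>\<real>\<^sup>n\<close> is modelled by the
  functions \<open>nat \<Rightarrow> real\<close> that are extensional on \<open>{..<n}\<close>, with the product
  topology and with the product Lebesgue measure of the library. Both have the same underlying
  set \<open>{..<n} \<rightarrow>\<^sub>E UNIV\<close>.
\<close>

abbreviation Rn :: "nat \<Rightarrow> (nat \<Rightarrow> real) topology" where
  "Rn n \<equiv> powertop_real {..<n}"

abbreviation lborel_Rn :: "nat \<Rightarrow> (nat \<Rightarrow> real) measure" where
  "lborel_Rn n \<equiv> (\<Pi>\<^sub>M i\<in>{..<n}. lborel)"

definition inner_Rn :: "nat \<Rightarrow> (nat \<Rightarrow> real) \<Rightarrow> (nat \<Rightarrow> real) \<Rightarrow> real" where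
  "inner_Rn n x y = (\<Sum>i<n. x i * y i)"

text \<open>The convex hull of \<open>S \<subseteq> \<real>\<^sup>n\<close> is \<open>convex_Rn n hull S\<close>.\<close>

definition convex_Rn :: "nat \<Rightarrow> (nat \<Rightarrow> real) set \<Rightarrow> bool" where
  "convex_Rn n S \<longleftrightarrow> S \<subseteq> topspace (Rn n) \<and>
     (\<forall>x\<in>S. \<forall>y\<in>S. \<forall>u\<ge>0. \<forall>v\<ge>0. u + v = 1 \<longrightarrow> (\<lambda>i\<in>{..<n}. u * x i + v * y i) \<in> S)"

definition convex_body :: "nat \<Rightarrow> (nat \<Rightarrow> real) set \<Rightarrow> bool" where
  "convex_body n K \<longleftrightarrow> compactin (Rn n) K \<and> convex_Rn n K \<and> Rn n interior_of K \<noteq> {}"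

definition unif :: "nat \<Rightarrow> (nat \<Rightarrow> real) set \<Rightarrow> (nat \<Rightarrow> real) measure" where
  "unif n K = uniform_measure (lborel_Rn n) K"

text \<open>
  The logarithmic Laplace transform of a probability measure takes values in
  \<open>(-\<infinity>, \<infinity>]\<close>; the integral below is always positive.
\<close>

definition log_laplace :: "nat \<Rightarrow> (nat \<Rightarrow> real) measure \<Rightarrow> (nat \<Rightarrow> real) \<Rightarrow> ereal" where
  "log_laplace n \<mu> \<theta> =
     (let I = (\<integral>\<^sup>+x. ennreal (exp (inner_Rn n \<theta> x)) \<partial>\<mu>)
      in if I = \<infinity> then \<infinity> else ereal (ln (enn2real I)))"

definition cramer :: "nat \<Rightarrow> (nat \<Rightarrow> real) measure \<Rightarrow> (nat \<Rightarrow> real) \<Rightarrow> ereal" where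
  "cramer n \<mu> x = (SUP \<theta>\<in>topspace (Rn n). ereal (inner_Rn n \<theta> x) - log_laplace n \<mu> \<theta>)"

definition exp_ereal :: "ereal \<Rightarrow> ereal" where
  "exp_ereal a = (case a of ereal r \<Rightarrow> ereal (exp r) | PInfty \<Rightarrow> \<infinity> | MInfty \<Rightarrow> 0)"

text \<open>
  The random vectors \<open>X\<^sub>1, X\<^sub>2, \<dots>\<close> are realised as the coordinates \<open>\<omega> 0, \<omega> 1, \<dots>\<close> of
  the infinite product of \<open>\<mu>\<close>; the probability only depends on their joint law. The infimum is
  taken in \<open>enat\<close>, so that it is \<open>\<infinity>\<close> if there is no suitable \<open>N\<close>.
\<close>

definition median_threshold :: "nat \<Rightarrow> (nat \<Rightarrow> real) measure \<Rightarrow> (nat \<Rightarrow> real) \<Rightarrow> enat" where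
  "median_threshold n \<mu> x =
     (INF N\<in>{N. \<P>(\<omega> in (\<Pi>\<^sub>M k\<in>(UNIV :: nat set). \<mu>).
                  x \<in> convex_Rn n hull (\<omega> ` {..<N})) \<ge> 1 / 2}. enat N)"

end

theory Submission
  imports Defs
begin

text \<open>
  Let \<open>q\<close> be the half-space depth of \<open>x\<close>, the infimum of the measure of a half-space whose boundary
  hyperplane contains \<open>x\<close>. Both inequalities go through \<open>q\<close>.

  Lower bound. If \<open>x\<close> lies in the convex hull of \<open>N\<close> sample points, then every half-space
  \<open>{p. \<langle>\<theta>, p\<rangle> \<ge> \<langle>\<theta>, x\<rangle>}\<close> contains one of them, so this event has probability at most \<open>N\<close> times the
  measure of the half-space, which Markov's inequality for \<open>exp \<langle>\<theta>, p\<rangle>\<close> bounds by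
  \<open>exp (\<Lambda> \<theta> - \<langle>\<theta>, x\<rangle>)\<close>. If the probability is at least \<open>1/2\<close>, then taking the best \<open>\<theta>\<close> gives
  \<open>2 N \<ge> exp (\<Lambda>\<^sup>* x)\<close> (\<open>cramer_le_ln_threshold\<close>).

  Upper bound, first part: about \<open>2 (n + 1) / q\<close> sample points suffice, for every probability
  measure (\<open>median_threshold_le_depth\<close>). Let \<open>D S\<close> be the squared distance from \<open>x\<close> to the hull of the
  sample points with index in \<open>S\<close>. If \<open>D S > 0\<close>, a further independent sample point decreases \<open>D\<close>
  whenever it lies in the half-space through \<open>x\<close> that faces away from the hull, hence with
  conditional probability at least \<open>q\<close> (\<open>hull_gap_decreases\<close>). On the other hand, by
  Caratheodory's theorem the point of the hull closest to \<open>x\<close> is a convex combination of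
  \<open>n + 1\<close> of the points, and the removal of any other point leaves \<open>D\<close> unchanged
  (\<open>card_essential_points_le\<close>). Summing the probability that the \<open>i\<close>-th of \<open>N\<close> points is essential
  over all \<open>i\<close> gives \<open>N q P(D > 0) \<le> n + 1\<close> (\<open>prob_not_in_hull_le\<close>).

  Upper bound, second part: for the uniform measure on a convex body,
  \<open>q \<ge> exp (- \<Lambda>\<^sup>* x) / (e * sqrt n)\<close>. For a linear functional \<open>Y\<close> that vanishes at \<open>x\<close> (after
  translation), the tail \<open>F u = P(Y \<ge> u)\<close> has a concave \<open>n\<close>-th root on its support; this is the
  Brunn--Minkowski inequality (\<open>brunn_minkowski\<close>). The tangent of \<open>F u powr (1/n)\<close> at \<open>0\<close> gives
  \<open>F u \<le> (g * (a - u)) ^ n\<close> for \<open>u \<le> a\<close>, with equality at \<open>u = 0\<close>, and \<open>F u = 0\<close> beyond \<open>a\<close>;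
  integrating against \<open>s * exp (s * u)\<close> for \<open>s = n / a\<close> yields \<open>E (exp (s * Y)) \<le> F 0 * n! * (e / n) ^ n \<le> e * sqrt n * F 0\<close>
  (\<open>exp_moment_le_tail\<close>). The left-hand side is at least \<open>exp (- \<Lambda>\<^sup>* x)\<close>.
\<close>

section \<open>The Brunn--Minkowski inequality\<close>

lemma power_weighted_sum_le:
  fixes u v x y :: real
  assumes "u > 0" "v > 0" "x \<ge> 0" "y \<ge> 0"
  shows "(u * x + v * y) ^ Suc n \<le> (u + v) ^ n * (u * x ^ Suc n + v * y ^ Suc n)"
proof -
  let ?S = "u + v"
  have S: "?S > 0" using assms by simp
  have "convex_on {0::real..} (\<lambda>x. x ^ Suc n)"
  proof (cases "even (Suc n)")
    case True
    from convex_power_even[OF this] show ?thesis by (rule convex_on_subset) auto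
  qed (rule convex_power_odd)
  moreover have "0 \<le> u / ?S" "0 \<le> v / ?S" "u / ?S + v / ?S = 1" "x \<in> {0..}" "y \<in> {0..}"
    using assms S add_divide_distrib[of u v ?S] by simp_all
  ultimately have "((u / ?S) *\<^sub>R x + (v / ?S) *\<^sub>R y) ^ Suc n \<le> (u / ?S) * x ^ Suc n + (v / ?S) * y ^ Suc n"
    by (auto simp only: convex_on_def)
  moreover have "(u / ?S) *\<^sub>R x + (v / ?S) *\<^sub>R y = (u * x + v * y) / ?S"
    by (simp add: add_divide_distrib)
  moreover have "(u / ?S) * x ^ Suc n + (v / ?S) * y ^ Suc n = (u * x ^ Suc n + v * y ^ Suc n) / ?S"
    by (simp add: add_divide_distrib)
  ultimately have "(u * x + v * y) ^ Suc n / ?S ^ Suc n \<le> (u * x ^ Suc n + v * y ^ Suc n) / ?S"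
    by (simp add: power_divide)
  then have "(u * x + v * y) ^ Suc n \<le> (u * x ^ Suc n + v * y ^ Suc n) / ?S * ?S ^ Suc n"
    using S by (simp add: pos_divide_le_eq)
  also have "\<dots> = ?S ^ n * (u * x ^ Suc n + v * y ^ Suc n)"
    using S by simp
  finally show ?thesis .
qed

text \<open>
  Layer cake. Truncation at height \<open>1\<close> confines the levels to the open unit interval, where the
  superlevel sets compared in the proof of the Brunn--Minkowski inequality are non-empty.
\<close>

lemma nn_integral_min_one_levels:
  fixes f :: "real \<Rightarrow> real"
  assumes [measurable]: "f \<in> borel_measurable borel" and nonneg: "\<And>x. 0 \<le> f x"
  shows "(\<integral>\<^sup>+x. ennreal (min 1 (f x)) \<partial>lborel)
    = (\<integral>\<^sup>+t. indicator {0<..<1} t * emeasure lborel {x. t < f x} \<partial>lborel)"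
proof -
  have *: "ennreal (min 1 (f x)) = (\<integral>\<^sup>+t. indicator {t. 0 < t \<and> t < 1 \<and> t < f x} t \<partial>lborel)" for x
  proof -
    have "{t. 0 < t \<and> t < 1 \<and> t < f x} = {0<..<min 1 (f x)}" by auto
    then show ?thesis using nonneg[of x] by simp
  qed
  have "(\<integral>\<^sup>+x. ennreal (min 1 (f x)) \<partial>lborel)
      = (\<integral>\<^sup>+x. (\<integral>\<^sup>+t. indicator {t. 0 < t \<and> t < 1 \<and> t < f x} t \<partial>lborel) \<partial>lborel)"
    by (simp only: *)
  also have "\<dots> = (\<integral>\<^sup>+t. (\<integral>\<^sup>+x. indicator {t. 0 < t \<and> t < 1 \<and> t < f x} t \<partial>lborel) \<partial>lborel)"
    by (rule lborel_pair.Fubini') (simp add: indicator_def)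
  also have "\<dots> = (\<integral>\<^sup>+t. indicator {0<..<1} t * emeasure lborel {x. t < f x} \<partial>lborel)"
  proof (rule nn_integral_cong)
    fix t
    have "(\<integral>\<^sup>+x. indicator {t. 0 < t \<and> t < 1 \<and> t < f x} t \<partial>lborel)
        = (\<integral>\<^sup>+x. indicator {0<..<1} t * indicator {x. t < f x} x \<partial>lborel)"
      by (intro nn_integral_cong) (auto simp: indicator_def)
    also have "\<dots> = indicator {0<..<1} t * emeasure lborel {x. t < f x}"
      by (subst nn_integral_cmult) auto
    finally show "(\<integral>\<^sup>+x. indicator {t. 0 < t \<and> t < 1 \<and> t < f x} t \<partial>lborel) = \<dots>" .
  qed
  finally show ?thesis .
qed

lemma emeasure_lborel_affine_image:
  fixes b c :: real
  assumes [measurable]: "S \<in> sets borel" and c: "c > 0"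
  shows "emeasure lborel {r. (r - b) / c \<in> S} = ennreal c * emeasure lborel S"
proof -
  have [measurable]: "{r. (r - b) / c \<in> S} \<in> sets borel" by measurable
  have "emeasure lborel {r. (r - b) / c \<in> S} = (\<integral>\<^sup>+r. indicator {r. (r - b) / c \<in> S} r \<partial>lborel)"
    by simp
  also have "\<dots> = \<bar>c\<bar> * (\<integral>\<^sup>+x. indicator {r. (r - b) / c \<in> S} (b + c * x) \<partial>lborel)"
    using c by (intro nn_integral_real_affine) auto
  also have "(\<lambda>x. indicator {r. (r - b) / c \<in> S} (b + c * x) :: ennreal) = indicator S"
    using c by (auto simp: indicator_def)
  finally show ?thesis using c by simp
qed

text \<open>
  The one-dimensional case: with \<open>s0\<close> near the supremum of \<open>S\<close> and \<open>t0\<close> near the infimum of \<open>T\<close>, the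
  set \<open>U\<close> contains a translate of \<open>a S\<close> up to \<open>s0\<close> and a translate of \<open>b T\<close> beyond \<open>t0\<close>. The two lie on
  different sides of \<open>a * s0 + b * t0\<close>.
\<close>

lemma emeasure_minkowski_sum_line:
  fixes S T U :: "real set" and R a b :: real
  assumes [measurable]: "S \<in> sets borel" "T \<in> sets borel" "U \<in> sets borel"
    and S: "S \<noteq> {}" "S \<subseteq> {-R..R}" and T: "T \<noteq> {}" "T \<subseteq> {-R..R}"
    and a: "a > 0" and b: "b > 0"
    and U: "\<And>s t. s \<in> S \<Longrightarrow> t \<in> T \<Longrightarrow> a * s + b * t \<in> U"
  shows "ennreal a * emeasure lborel S + ennreal b * emeasure lborel T \<le> emeasure lborel U"
proof (rule ennreal_le_epsilon)
  fix e :: real assume e: "0 < e"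
  define d where "d = e / (a + b)"
  have "(a + b) * d = e" using a b by (simp add: d_def)
  then have d: "d > 0" "a * d + b * d = e"
    using e a b by (simp add: d_def, simp only: distrib_right)
  have bS: "bdd_above S" and bT: "bdd_below T"
    using S T by (meson atLeastAtMost_iff bdd_above.I bdd_below.I subsetD)+
  obtain s0 where s0: "s0 \<in> S" "Sup S - d < s0"
    using less_cSup_iff[OF S(1) bS, of "Sup S - d"] d by auto
  obtain t0 where t0: "t0 \<in> T" "t0 < Inf T + d"
    using cInf_less_iff[OF T(1) bT, of "Inf T + d"] d by auto
  define S' where "S' = S \<inter> {..s0}"
  define T' where "T' = T \<inter> {t0<..}"
  have [measurable]: "S' \<in> sets borel" "T' \<in> sets borel" by (auto simp: S'_def T'_def)
  have "emeasure lborel S \<le> emeasure lborel (S' \<union> {s0..Sup S})"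
    using bS by (intro emeasure_mono) (auto simp: S'_def intro: cSup_upper)
  also have "\<dots> \<le> emeasure lborel S' + emeasure lborel {s0..Sup S}"
    by (intro emeasure_subadditive) auto
  also have "\<dots> \<le> emeasure lborel S' + ennreal d"
    using s0 bS cSup_upper[OF s0(1) bS] by (intro add_left_mono) (auto intro: ennreal_leI)
  finally have 1: "emeasure lborel S \<le> emeasure lborel S' + ennreal d" .
  have "emeasure lborel T \<le> emeasure lborel (T' \<union> {Inf T..t0})"
    using bT by (intro emeasure_mono) (auto simp: T'_def intro: cInf_lower)
  also have "\<dots> \<le> emeasure lborel T' + emeasure lborel {Inf T..t0}"
    by (intro emeasure_subadditive) auto
  also have "\<dots> \<le> emeasure lborel T' + ennreal d"
    using t0 bT cInf_lower[OF t0(1) bT] by (intro add_left_mono) (auto intro: ennreal_leI)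
  finally have 2: "emeasure lborel T \<le> emeasure lborel T' + ennreal d" .
  let ?S = "{r. (r - b * t0) / a \<in> S'}" and ?T = "{r. (r - a * s0) / b \<in> T'}"
  have [measurable]: "?S \<in> sets borel" "?T \<in> sets borel" by measurable
  have disj: "?S \<inter> ?T = {}"
    using a b by (auto simp: S'_def T'_def field_simps)
  have sub: "?S \<union> ?T \<subseteq> U"
  proof safe
    fix r assume "(r - b * t0) / a \<in> S'"
    then have "a * ((r - b * t0) / a) + b * t0 \<in> U" by (intro U t0) (simp add: S'_def)
    moreover have "a * ((r - b * t0) / a) + b * t0 = r" using a by simp
    ultimately show "r \<in> U" by simp
  next
    fix r assume "(r - a * s0) / b \<in> T'"
    then have "a * s0 + b * ((r - a * s0) / b) \<in> U" by (intro U s0) (simp add: T'_def)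
    moreover have "a * s0 + b * ((r - a * s0) / b) = r" using b by simp
    ultimately show "r \<in> U" by simp
  qed
  have "ennreal a * emeasure lborel S' + ennreal b * emeasure lborel T'
      = emeasure lborel ?S + emeasure lborel ?T"
    using a b by (simp add: emeasure_lborel_affine_image)
  also have "\<dots> = emeasure lborel (?S \<union> ?T)"
    using disj by (intro plus_emeasure) auto
  also have "\<dots> \<le> emeasure lborel U"
    using sub by (intro emeasure_mono) auto
  finally have 3: "ennreal a * emeasure lborel S' + ennreal b * emeasure lborel T' \<le> emeasure lborel U" .
  have "ennreal a * emeasure lborel S + ennreal b * emeasure lborel T
      \<le> ennreal a * (emeasure lborel S' + ennreal d) + ennreal b * (emeasure lborel T' + ennreal d)"
    by (intro add_mono mult_left_mono 1 2) auto
  also have "\<dots> = (ennreal a * emeasure lborel S' + ennreal b * emeasure lborel T') + ennreal (a * d + b * d)"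
  proof -
    have "ennreal (a * d + b * d) = ennreal a * ennreal d + ennreal b * ennreal d"
      using a b d(1) by (simp add: ennreal_mult)
    then show ?thesis by (simp only: distrib_left add.assoc add.left_commute)
  qed
  also have "\<dots> \<le> emeasure lborel U + ennreal e"
    using 3 d by (simp add: add_right_mono)
  finally show "ennreal a * emeasure lborel S + ennreal b * emeasure lborel T \<le> emeasure lborel U + ennreal e" .
qed

interpretation lborel_family: product_sigma_finite "\<lambda>_::nat. lborel :: real measure"
  by unfold_locales

definition cube :: "nat \<Rightarrow> real \<Rightarrow> (nat \<Rightarrow> real) set" where
  "cube n R = (\<Pi>\<^sub>E i\<in>{..<n}. {-R..R})"

lemma emeasure_cube: "R \<ge> 0 \<Longrightarrow> emeasure (lborel_Rn n) (cube n R) = ennreal ((2 * R) ^ n)"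
  unfolding cube_def by (subst lborel_family.emeasure_PiM) (auto simp: ennreal_power)

definition slice :: "nat \<Rightarrow> (nat \<Rightarrow> real) set \<Rightarrow> real \<Rightarrow> (nat \<Rightarrow> real) set" where
  "slice n A s = {x \<in> space (lborel_Rn n). x(n := s) \<in> A}"

lemma cube_sets [measurable]: "cube n R \<in> sets (lborel_Rn n)"
  unfolding cube_def by (intro sets_PiM_I_finite) auto

lemma slice_measurable_pair:
  assumes "A \<in> sets (lborel_Rn (Suc n))"
  shows "{p \<in> space (lborel_Rn n \<Otimes>\<^sub>M lborel). (fst p)(n := snd p) \<in> A} \<in> sets (lborel_Rn n \<Otimes>\<^sub>M lborel)"
proof -
  have "(\<lambda>(f, y). f(n := y)) \<in> measurable (lborel_Rn n \<Otimes>\<^sub>M lborel) (lborel_Rn (Suc n))"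
    unfolding lessThan_Suc by (rule measurable_add_dim)
  from measurable_sets[OF this assms]
  show ?thesis by (simp add: vimage_def case_prod_beta Int_def conj_commute)
qed

lemma slice_sets [measurable]:
  assumes "A \<in> sets (lborel_Rn (Suc n))"
  shows "slice n A s \<in> sets (lborel_Rn n)"
proof -
  have "slice n A s = (\<lambda>x. (x, s)) -` {p \<in> space (lborel_Rn n \<Otimes>\<^sub>M lborel). (fst p)(n := snd p) \<in> A} \<inter> space (lborel_Rn n)"
    by (auto simp: slice_def space_pair_measure)
  then show ?thesis
    using measurable_sets[OF measurable_Pair2'[of s lborel "lborel_Rn n"] slice_measurable_pair[OF assms]] by simp
qed

lemma emeasure_slices:
  assumes A: "A \<in> sets (lborel_Rn (Suc n))"
  shows "emeasure (lborel_Rn (Suc n)) A = (\<integral>\<^sup>+s. emeasure (lborel_Rn n) (slice n A s) \<partial>lborel)"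
    and "(\<lambda>s. emeasure (lborel_Rn n) (slice n A s)) \<in> borel_measurable borel"
proof -
  have "emeasure (lborel_Rn (Suc n)) A = (\<integral>\<^sup>+x. indicator A x \<partial>lborel_Rn (Suc n))"
    using A by simp
  also have "\<dots> = (\<integral>\<^sup>+s. (\<integral>\<^sup>+x. indicator A (x(n := s)) \<partial>lborel_Rn n) \<partial>lborel)"
    using A unfolding lessThan_Suc by (subst lborel_family.product_nn_integral_insert_rev) auto
  also have "\<dots> = (\<integral>\<^sup>+s. emeasure (lborel_Rn n) (slice n A s) \<partial>lborel)"
  proof (rule nn_integral_cong)
    fix s
    have "(\<integral>\<^sup>+x. indicator A (x(n := s)) \<partial>lborel_Rn n) = (\<integral>\<^sup>+x. indicator (slice n A s) x \<partial>lborel_Rn n)"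
      by (intro nn_integral_cong) (auto simp: slice_def indicator_def)
    also have "\<dots> = emeasure (lborel_Rn n) (slice n A s)"
      using slice_sets[OF A] by simp
    finally show "(\<integral>\<^sup>+x. indicator A (x(n := s)) \<partial>lborel_Rn n) = \<dots>" .
  qed
  finally show "emeasure (lborel_Rn (Suc n)) A = (\<integral>\<^sup>+s. emeasure (lborel_Rn n) (slice n A s) \<partial>lborel)" .
  interpret finite_product_sigma_finite "\<lambda>_::nat. lborel :: real measure" "{..<n}"
    by unfold_locales auto
  interpret P: pair_sigma_finite lborel "lborel_Rn n"
    by unfold_locales
  let ?Q = "{p \<in> space (lborel \<Otimes>\<^sub>M lborel_Rn n). (snd p)(n := fst p) \<in> A}"
  have "(\<lambda>(f, y). f(n := y)) \<in> measurable (lborel_Rn n \<Otimes>\<^sub>M lborel) (lborel_Rn (Suc n))"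
    unfolding lessThan_Suc by (rule measurable_add_dim)
  then have "(\<lambda>p. (snd p)(n := fst p)) \<in> measurable (lborel \<Otimes>\<^sub>M lborel_Rn n) (lborel_Rn (Suc n))"
    using measurable_compose[OF measurable_pair_swap'[of lborel "lborel_Rn n"]]
    by (fastforce simp: case_prod_beta)
  from measurable_sets[OF this A] have "?Q \<in> sets (lborel \<Otimes>\<^sub>M lborel_Rn n)"
    by (simp add: vimage_def Int_def conj_commute)
  from measurable_emeasure_Pair[OF this]
  have "(\<lambda>s. emeasure (lborel_Rn n) (Pair s -` ?Q)) \<in> borel_measurable lborel" .
  moreover have "Pair s -` ?Q = slice n A s" for s
    by (auto simp: slice_def space_pair_measure)
  ultimately show "(\<lambda>s. emeasure (lborel_Rn n) (slice n A s)) \<in> borel_measurable borel"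
    by simp
qed

lemma slice_cube:
  assumes "A \<subseteq> cube (Suc n) R"
  shows "slice n A s \<subseteq> cube n R" and "s \<notin> {-R..R} \<Longrightarrow> slice n A s = {}"
proof -
  have *: "x \<in> cube n R \<and> s \<in> {-R..R}" if "x \<in> slice n A s" for x
  proof -
    from that have x: "x \<in> extensional {..<n}" "x(n := s) \<in> cube (Suc n) R"
      using assms by (auto simp: slice_def space_PiM PiE_iff)
    have b: "(x(n := s)) i \<in> {-R..R}" if "i < Suc n" for i
      using PiE_mem[OF x(2)[unfolded cube_def], of i] that by simp
    have "(x(n := s)) n \<in> {-R..R}" by (rule b) simp
    moreover have "\<forall>i<n. (x(n := s)) i \<in> {-R..R}" by (intro allI impI b) simp
    ultimately show ?thesis using x(1) by (auto simp: cube_def PiE_iff split: if_splits)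
  qed
  show "slice n A s \<subseteq> cube n R" using * by auto
  show "s \<notin> {-R..R} \<Longrightarrow> slice n A s = {}" using * by auto
qed

lemma emeasure_finite_in_cube:
  assumes "A \<subseteq> cube n R" 
  shows "emeasure (lborel_Rn n) A = ennreal (measure (lborel_Rn n) A)"
    and "measure (lborel_Rn n) A \<le> (2 * \<bar>R\<bar>) ^ n"
proof -
  have "A \<subseteq> cube n \<bar>R\<bar>" using assms unfolding cube_def by (force simp: PiE_iff)
  then have *: "emeasure (lborel_Rn n) A \<le> ennreal ((2 * \<bar>R\<bar>) ^ n)"
    using emeasure_mono[of A "cube n \<bar>R\<bar>" "lborel_Rn n"] emeasure_cube[of "\<bar>R\<bar>" n] by simp
  then have "emeasure (lborel_Rn n) A \<noteq> \<infinity>" by (auto simp: top_unique)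
  then show 1: "emeasure (lborel_Rn n) A = ennreal (measure (lborel_Rn n) A)"
    by (simp add: emeasure_eq_ennreal_measure top.not_eq_extremum)
  show "measure (lborel_Rn n) A \<le> (2 * \<bar>R\<bar>) ^ n"
    using * unfolding 1 by (subst (asm) ennreal_le_iff) auto
qed

lemma measure_Rn_0:
  assumes "A \<subseteq> space (lborel_Rn 0)" "A \<noteq> {}"
  shows "measure (lborel_Rn 0) A = 1"
proof -
  have "A = space (lborel_Rn 0)" using assms by (auto simp: space_PiM)
  moreover have "emeasure (lborel_Rn 0) (space (lborel_Rn 0)) = 1"
    by (simp add: PiM_empty space_PiM)
  ultimately show ?thesis by (simp add: measure_def)
qed

text \<open>
  The measures of the slices of \<open>A\<close> have a supremum \<open>p ^ n > 0\<close>. For \<open>n = 0\<close> every non-empty slice has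
  measure \<open>1\<close>, and \<open>p = 1\<close> serves. The supremum need not be attained, but every level below it is
  exceeded.
\<close>

lemma slice_sup:
  assumes A: "A \<in> sets (lborel_Rn (Suc n))" "A \<subseteq> cube (Suc n) R" "emeasure (lborel_Rn (Suc n)) A > 0"
  obtains p where "p > 0" "\<And>s. measure (lborel_Rn n) (slice n A s) \<le> p ^ n"
    "\<And>t. t < 1 \<Longrightarrow> \<exists>s. t * p ^ n < measure (lborel_Rn n) (slice n A s)"
proof -
  let ?f = "\<lambda>s. measure (lborel_Rn n) (slice n A s)"
  have e: "emeasure (lborel_Rn n) (slice n A s) = ennreal (?f s)" for s
    by (rule emeasure_finite_in_cube(1)[OF slice_cube(1)[OF A(2)]])
  have bdd: "bdd_above (range ?f)"
    by (rule bdd_aboveI[where M = "(2 * \<bar>R\<bar>) ^ n"])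
      (use emeasure_finite_in_cube(2)[OF slice_cube(1)[OF A(2)]] in auto)
  define M where "M = (SUP s. ?f s)"
  have le: "?f s \<le> M" for s unfolding M_def by (rule cSUP_upper) (auto intro: bdd)
  have ex: "\<exists>s. y < ?f s" if "y < M" for y
    using that less_cSUP_iff[OF _ bdd] unfolding M_def by auto
  have M0: "M > 0"
  proof (rule ccontr)
    assume "\<not> M > 0"
    then have "?f s = 0" for s using le[of s] measure_nonneg[of "lborel_Rn n" "slice n A s"] by linarith
    then have "emeasure (lborel_Rn (Suc n)) A = 0"
      unfolding emeasure_slices(1)[OF A(1)] e by simp
    then show False using A(3) by simp
  qed
  show thesis
  proof (cases "n = 0")
    case True
    have f01: "?f s = 1" if "slice n A s \<noteq> {}" for s
      using measure_Rn_0[of "slice n A s"] that True by (auto simp: slice_def)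
    have "?f s \<le> 1" for s by (cases "slice n A s = {}") (auto simp: f01)
    moreover obtain s where s: "0 < ?f s" using ex[OF M0] by auto
    then have "?f s = 1" by (intro f01) auto
    then have "\<exists>s. t * 1 ^ n < ?f s" if "t < 1" for t
      using that by (intro exI[of _ s]) simp
    ultimately show thesis by (intro that[of 1]) auto
  next
    case False
    define p where "p = root n M"
    have p: "p > 0" "p ^ n = M" using False M0 by (auto simp: p_def)
    show thesis
      using p le ex M0 by (intro that[of p]) auto
  qed
qed

text \<open>
  The inequality \<open>|a A + b B| powr (1/n) \<ge> a |A| powr (1/n) + b |B| powr (1/n)\<close>, with the measure of each
  set bounded by an \<open>n\<close>-th power, so that the induction on \<open>n\<close> also covers \<open>n = 0\<close>.

  Let \<open>P ^ n\<close> and \<open>Q ^ n\<close> be the suprema of the slice measures of \<open>A\<close> and \<open>B\<close>. If the slices of \<open>A\<close> at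
  \<open>s\<close> and of \<open>B\<close> at \<open>s'\<close> have at least the fraction \<open>t\<close> of these suprema, the induction hypothesis gives
  the slice of \<open>C\<close> at \<open>a * s + b * s'\<close> a measure of at least \<open>t * (a * P + b * Q) ^ n\<close>. The superlevel
  sets of the normalised slice functions are therefore related as in the one-dimensional case.
  Integrating over \<open>t\<close> gives
  \<open>|C| \<ge> (a * P + b * Q) ^ n * (a * |A| / P ^ n + b * |B| / Q ^ n)\<close>, and convexity of the power function
  concludes. The normalisation makes the superlevel sets non-empty for all \<open>t < 1\<close> simultaneously.
\<close>

theorem brunn_minkowski:
  fixes a b :: real
  assumes "A \<in> sets (lborel_Rn n)" "B \<in> sets (lborel_Rn n)" "C \<in> sets (lborel_Rn n)"
    and "A \<subseteq> cube n R" "B \<subseteq> cube n R" "C \<subseteq> cube n R"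
    and "a > 0" "b > 0" "p > 0" "q > 0"
    and "ennreal (p ^ n) \<le> emeasure (lborel_Rn n) A" "ennreal (q ^ n) \<le> emeasure (lborel_Rn n) B"
    and "\<And>x y. x \<in> A \<Longrightarrow> y \<in> B \<Longrightarrow> (\<lambda>i\<in>{..<n}. a * x i + b * y i) \<in> C"
  shows "ennreal ((a * p + b * q) ^ n) \<le> emeasure (lborel_Rn n) C"
  using assms
proof (induction n arbitrary: A B C p q)
  case 0
  have "A \<noteq> {}" "B \<noteq> {}" using 0 by auto
  then have "C \<noteq> {}" using 0 by blast
  then have "measure (lborel_Rn 0) C = 1"
    using 0(3) by (intro measure_Rn_0) (auto dest: sets.sets_into_space)
  then show ?case
    using emeasure_finite_in_cube(1)[OF 0(6)] by simp
next
  case (Suc n)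
  note [measurable] = Suc.prems(1-3)
  let ?L = "lborel_Rn n"
  define fA where "fA s = measure ?L (slice n A s)" for s
  define fB where "fB s = measure ?L (slice n B s)" for s
  define fC where "fC s = measure ?L (slice n C s)" for s
  have eA: "emeasure ?L (slice n A s) = ennreal (fA s)"
   and eB: "emeasure ?L (slice n B s) = ennreal (fB s)"
   and eC: "emeasure ?L (slice n C s) = ennreal (fC s)" for s
    unfolding fA_def fB_def fC_def
    by (rule emeasure_finite_in_cube(1)[OF slice_cube(1)], rule Suc.prems)+
  have [measurable]: "fA \<in> borel_measurable borel" "fB \<in> borel_measurable borel" "fC \<in> borel_measurable borel"
    unfolding fA_def fB_def fC_def measure_def
    by (intro borel_measurable_enn2real emeasure_slices(2) Suc.prems)+
  have pos: "0 \<le> fA s" "0 \<le> fB s" "0 \<le> fC s" for s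
    by (auto simp: fA_def fB_def fC_def)
  have "0 < emeasure (lborel_Rn (Suc n)) A" "0 < emeasure (lborel_Rn (Suc n)) B"
    using Suc.prems by (auto intro!: less_le_trans[OF _ Suc.prems(11)] less_le_trans[OF _ Suc.prems(12)])
  note posAB = this
  obtain P where P: "P > 0" "\<And>s. fA s \<le> P ^ n" "\<And>t. t < 1 \<Longrightarrow> \<exists>s. t * P ^ n < fA s"
    using slice_sup[OF Suc.prems(1,4) posAB(1)] unfolding fA_def by metis
  obtain Q where Q: "Q > 0" "\<And>s. fB s \<le> Q ^ n" "\<And>t. t < 1 \<Longrightarrow> \<exists>s. t * Q ^ n < fB s"
    using slice_sup[OF Suc.prems(2,5) posAB(2)] unfolding fB_def by metis
  define W where "W = (a * P + b * Q) ^ n"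
  have W: "W > 0" unfolding W_def using Suc.prems P Q by (intro zero_less_power add_pos_pos mult_pos_pos) auto
  have step: "t * W \<le> fC (a * s + b * s')"
    if t: "0 < t" and s: "t * P ^ n \<le> fA s" "t * Q ^ n \<le> fB s'" for t s s'
  proof -
    have sl: "(\<lambda>i\<in>{..<n}. a * x i + b * y i) \<in> slice n C (a * s + b * s')"
      if "x \<in> slice n A s" "y \<in> slice n B s'" for x y
    proof -
      have "(\<lambda>i\<in>{..<Suc n}. a * (x(n := s)) i + b * (y(n := s')) i) \<in> C"
        by (rule Suc.prems(13)) (use that in \<open>auto simp only: slice_def mem_Collect_eq\<close>)
      moreover have "(\<lambda>i\<in>{..<Suc n}. a * (x(n := s)) i + b * (y(n := s')) i)
          = (\<lambda>i\<in>{..<n}. a * x i + b * y i)(n := a * s + b * s')"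
        by (rule ext) (simp add: restrict_def less_Suc_eq)
      ultimately show ?thesis by (simp add: slice_def space_PiM)
    qed
    show ?thesis
    proof (cases "n = 0")
      case True
      have "0 < fA s" "0 < fB s'"
        using s t True by simp_all
      then have "slice n A s \<noteq> {}" "slice n B s' \<noteq> {}" by (auto simp: fA_def fB_def)
      then have "slice n C (a * s + b * s') \<noteq> {}" using sl by blast
      then have "fC (a * s + b * s') = 1"
        unfolding fC_def True by (intro measure_Rn_0) (auto simp: slice_def)
      moreover have "t \<le> 1"
        using s(1) P(2)[of s] True by simp
      ultimately show ?thesis by (simp add: True W_def)
    next
      case False
      define r where "r = root n t"
      have r: "r > 0" "r ^ n = t" using False t by (auto simp: r_def)
      have "ennreal ((a * (r * P) + b * (r * Q)) ^ n) \<le> emeasure ?L (slice n C (a * s + b * s'))"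
      proof (rule Suc.IH)
        show "ennreal ((r * P) ^ n) \<le> emeasure ?L (slice n A s)"
          "ennreal ((r * Q) ^ n) \<le> emeasure ?L (slice n B s')"
          using s r by (auto simp: eA eB power_mult_distrib intro!: ennreal_leI)
      next
        fix x y assume "x \<in> slice n A s" "y \<in> slice n B s'"
        then show "(\<lambda>i\<in>{..<n}. a * x i + b * y i) \<in> slice n C (a * s + b * s')" by (rule sl)
      next
        show "slice n A s \<subseteq> cube n R" "slice n B s' \<subseteq> cube n R" "slice n C (a * s + b * s') \<subseteq> cube n R"
          by (rule slice_cube(1), rule Suc.prems)+
      qed (use Suc.prems(1-3,7-8) r P(1) Q(1) in auto)
      also have "(a * (r * P) + b * (r * Q)) ^ n = t * W"
      proof -
        have "a * (r * P) + b * (r * Q) = r * (a * P + b * Q)" by (simp add: algebra_simps)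
        then show ?thesis by (simp only: W_def power_mult_distrib r(2))
      qed
      finally show ?thesis using pos by (simp add: eC)
    qed
  qed
  have levels: "ennreal a * emeasure lborel {s. t < fA s / P ^ n} + ennreal b * emeasure lborel {s. t < fB s / Q ^ n}
      \<le> emeasure lborel {s. t < fC s / W}" if t: "0 < t" "t < 1" for t
  proof (rule emeasure_minkowski_sum_line[where R = R])
    show "{s. t < fA s / P ^ n} \<noteq> {}" "{s. t < fB s / Q ^ n} \<noteq> {}"
      using P Q t by (auto simp: field_simps)
    have "fA s = 0" "fB s = 0" if "s \<notin> {-R..R}" for s
      using slice_cube(2)[OF Suc.prems(4) that] slice_cube(2)[OF Suc.prems(5) that]
      by (auto simp: fA_def fB_def)
    then show "{s. t < fA s / P ^ n} \<subseteq> {-R..R}" "{s. t < fB s / Q ^ n} \<subseteq> {-R..R}"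
      using t by (auto, (metis div_0 less_asym atLeastAtMost_iff)+)
  next
    fix s s' assume "s \<in> {s. t < fA s / P ^ n}" "s' \<in> {s. t < fB s / Q ^ n}"
    \<comment> \<open>A level strictly between, since the induction hypothesis preserves only weak inequalities.\<close>
    then obtain t' where t': "t < t'" "t' \<le> fA s / P ^ n" "t' \<le> fB s' / Q ^ n"
      using that[of "min (fA s / P ^ n) (fB s' / Q ^ n)"] by (auto simp: min_def)
    then have "t' * W \<le> fC (a * s + b * s')"
      using t P Q by (intro step) (auto simp: pos_le_divide_eq)
    then have "t' \<le> fC (a * s + b * s') / W" using W by (simp add: pos_le_divide_eq)
    then show "a * s + b * s' \<in> {s. t < fC s / W}" using t' by simp
  qed (use Suc.prems in auto)
  let ?m = "\<lambda>f. \<integral>\<^sup>+s. ennreal (min 1 (f s)) \<partial>lborel"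
  have mA: "?m (\<lambda>s. fA s / P ^ n) = (\<integral>\<^sup>+t. indicator {0<..<1} t * emeasure lborel {s. t < fA s / P ^ n} \<partial>lborel)"
    using pos P(1) by (intro nn_integral_min_one_levels) auto
  have mB: "?m (\<lambda>s. fB s / Q ^ n) = (\<integral>\<^sup>+t. indicator {0<..<1} t * emeasure lborel {s. t < fB s / Q ^ n} \<partial>lborel)"
    using pos Q(1) by (intro nn_integral_min_one_levels) auto
  have mC: "?m (\<lambda>s. fC s / W) = (\<integral>\<^sup>+t. indicator {0<..<1} t * emeasure lborel {s. t < fC s / W} \<partial>lborel)"
    using pos W by (intro nn_integral_min_one_levels) auto
  have meas: "(\<lambda>t. emeasure lborel {s. t < f s}) \<in> borel_measurable borel"
    if [measurable]: "f \<in> borel_measurable borel" for f :: "real \<Rightarrow> real"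
  proof -
    have "{p \<in> space (borel \<Otimes>\<^sub>M lborel). fst p < f (snd p)} \<in> sets (borel \<Otimes>\<^sub>M (lborel :: real measure))"
      by measurable
    then have "(\<lambda>t. emeasure lborel (Pair t -` {p \<in> space (borel \<Otimes>\<^sub>M lborel). fst p < f (snd p)}))
      \<in> borel_measurable borel"
      by (rule lborel.measurable_emeasure_Pair)
    then show ?thesis by (simp add: space_pair_measure vimage_def)
  qed
  have [measurable]: "(\<lambda>t. emeasure lborel {s. t < fA s / P ^ n}) \<in> borel_measurable borel"
      "(\<lambda>t. emeasure lborel {s. t < fB s / Q ^ n}) \<in> borel_measurable borel"
    by (intro meas; simp)+
  have int: "ennreal a * ?m (\<lambda>s. fA s / P ^ n) + ennreal b * ?m (\<lambda>s. fB s / Q ^ n) \<le> ?m (\<lambda>s. fC s / W)"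
  proof -
    let ?I = "indicator {0<..<1} :: real \<Rightarrow> ennreal"
    have "ennreal a * ?m (\<lambda>s. fA s / P ^ n) + ennreal b * ?m (\<lambda>s. fB s / Q ^ n)
      = (\<integral>\<^sup>+t. ennreal a * (?I t * emeasure lborel {s. t < fA s / P ^ n})
          + ennreal b * (?I t * emeasure lborel {s. t < fB s / Q ^ n}) \<partial>lborel)"
      unfolding mA mB by (simp add: nn_integral_add nn_integral_cmult)
    also have "\<dots> \<le> ?m (\<lambda>s. fC s / W)"
      unfolding mC using levels by (intro nn_integral_mono) (auto simp: indicator_def)
    finally show ?thesis .
  qed
  have scale: "(\<integral>\<^sup>+s. ennreal (f s) \<partial>lborel) = ennreal c * (\<integral>\<^sup>+s. ennreal (f s / c) \<partial>lborel)"
    if "c > 0" "\<And>s. 0 \<le> f s" and [measurable]: "f \<in> borel_measurable borel" for f :: "real \<Rightarrow> real" and c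
    using that by (subst nn_integral_cmult[symmetric]) (auto simp flip: ennreal_mult)
  have IA: "emeasure (lborel_Rn (Suc n)) A = ennreal (P ^ n) * ?m (\<lambda>s. fA s / P ^ n)"
    using P pos unfolding emeasure_slices(1)[OF Suc.prems(1)] eA
    by (subst scale[of "P ^ n" fA]) (simp_all add: min_absorb2)
  have IB: "emeasure (lborel_Rn (Suc n)) B = ennreal (Q ^ n) * ?m (\<lambda>s. fB s / Q ^ n)"
    using Q pos unfolding emeasure_slices(1)[OF Suc.prems(2)] eB
    by (subst scale[of "Q ^ n" fB]) (simp_all add: min_absorb2)
  have IC: "ennreal W * ?m (\<lambda>s. fC s / W) \<le> emeasure (lborel_Rn (Suc n)) C"
    using W pos unfolding emeasure_slices(1)[OF Suc.prems(3)] eC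
    by (subst scale[of "W" fC]) (simp_all add: mult_left_mono nn_integral_mono ennreal_leI)
  have lower: "ennreal (p ^ Suc n / P ^ n) \<le> m" if "ennreal (p ^ Suc n) \<le> ennreal (P ^ n) * m" "P > 0" "p > 0" for p P m
  proof -
    have "ennreal (p ^ Suc n / P ^ n) = ennreal (p ^ Suc n) / ennreal (P ^ n)"
      using that by (intro divide_ennreal[symmetric]) auto
    also have "\<dots> \<le> (ennreal (P ^ n) * m) / ennreal (P ^ n)"
      using that by (intro divide_right_mono_ennreal) auto
    also have "\<dots> = m"
      using that by (simp add: mult.commute mult_divide_eq_ennreal)
    finally show ?thesis .
  qed
  have lA: "ennreal (p ^ Suc n / P ^ n) \<le> ?m (\<lambda>s. fA s / P ^ n)"
    using Suc.prems P by (intro lower) (auto simp: IA)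
  have lB: "ennreal (q ^ Suc n / Q ^ n) \<le> ?m (\<lambda>s. fB s / Q ^ n)"
    using Suc.prems Q by (intro lower) (auto simp: IB)
  have "(a * p + b * q) ^ Suc n = ((a * P) * (p / P) + (b * Q) * (q / Q)) ^ Suc n"
    using P Q by simp
  also have "\<dots> \<le> (a * P + b * Q) ^ n * ((a * P) * (p / P) ^ Suc n + (b * Q) * (q / Q) ^ Suc n)"
    using Suc.prems P Q by (intro power_weighted_sum_le) auto
  also have "\<dots> = W * (a * (p ^ Suc n / P ^ n) + b * (q ^ Suc n / Q ^ n))"
    using P Q unfolding W_def by (simp add: power_divide)
  finally have "ennreal ((a * p + b * q) ^ Suc n) \<le> ennreal (W * (a * (p ^ Suc n / P ^ n) + b * (q ^ Suc n / Q ^ n)))"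
    by (rule ennreal_leI)
  also have "\<dots> = ennreal W * (ennreal a * ennreal (p ^ Suc n / P ^ n) + ennreal b * ennreal (q ^ Suc n / Q ^ n))"
  proof -
    have *: "ennreal (W * (a * x + b * y)) = ennreal W * (ennreal a * ennreal x + ennreal b * ennreal y)"
      if "x \<ge> 0" "y \<ge> 0" for x y
      using that W Suc.prems(7,8) by (simp add: ennreal_mult)
    show ?thesis by (rule *) (use Suc.prems(9,10) P(1) Q(1) in simp_all)
  qed
  also have "\<dots> \<le> ennreal W * (ennreal a * ?m (\<lambda>s. fA s / P ^ n) + ennreal b * ?m (\<lambda>s. fB s / Q ^ n))"
    by (intro mult_left_mono add_mono lA lB) auto
  also have "\<dots> \<le> ennreal W * ?m (\<lambda>s. fC s / W)"
    by (intro mult_left_mono int) auto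
  also note IC
  finally show ?case .
qed

section \<open>Caratheodory's theorem and the distance to a convex hull\<close>

text \<open>
  Gaussian elimination: a vector with non-zero last coordinate is used to clear that coordinate
  in the others.
\<close>

lemma linear_dependence:
  fixes v :: "'i \<Rightarrow> nat \<Rightarrow> real"
  assumes "finite S" "card S > m"
  obtains c where "\<exists>i\<in>S. c i \<noteq> 0" "\<And>j. j < m \<Longrightarrow> (\<Sum>i\<in>S. c i * v i j) = 0"
proof -
  have "\<exists>c. (\<exists>i\<in>S. c i \<noteq> 0) \<and> (\<forall>j<m. (\<Sum>i\<in>S. c i * v i j) = 0)"
    using assms
  proof (induction m arbitrary: S v)
    case 0
    then have "S \<noteq> {}" by auto
    then show ?case by (intro exI[of _ "\<lambda>_. 1"]) auto
  next
    case (Suc m)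
    show ?case
    proof (cases "\<forall>i\<in>S. v i m = 0")
      case True
      obtain c where c: "\<exists>i\<in>S. c i \<noteq> 0" "\<forall>j<m. (\<Sum>i\<in>S. c i * v i j) = 0"
        using Suc.IH[of S v] Suc.prems by auto
      moreover have "(\<Sum>i\<in>S. c i * v i m) = 0" using True by simp
      ultimately show ?thesis by (auto simp: less_Suc_eq)
    next
      case False
      then obtain k where k: "k \<in> S" "v k m \<noteq> 0" by auto
      define u where "u i j = v i j - v i m / v k m * v k j" for i j
      have "finite (S - {k})" "card (S - {k}) > m" using Suc.prems k by auto
      then obtain c where c: "\<exists>i\<in>S-{k}. c i \<noteq> 0" "\<forall>j<m. (\<Sum>i\<in>S-{k}. c i * u i j) = 0"
        using Suc.IH[of "S - {k}" u] by auto
      define d where "d = c(k := - (\<Sum>i\<in>S-{k}. c i * v i m / v k m))"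
      have *: "(\<Sum>i\<in>S. d i * v i j) = (\<Sum>i\<in>S-{k}. c i * u i j)" for j
      proof -
        have "(\<Sum>i\<in>S. d i * v i j) = d k * v k j + (\<Sum>i\<in>S-{k}. d i * v i j)"
          using Suc.prems k by (simp add: sum.remove)
        also have "(\<Sum>i\<in>S-{k}. d i * v i j) = (\<Sum>i\<in>S-{k}. c i * v i j)"
          by (intro sum.cong) (auto simp: d_def)
        also have "d k * v k j = - (\<Sum>i\<in>S-{k}. c i * v i m / v k m * v k j)"
          by (simp add: d_def sum_distrib_right)
        also have "\<dots> + (\<Sum>i\<in>S-{k}. c i * v i j) = (\<Sum>i\<in>S-{k}. c i * v i j - c i * v i m / v k m * v k j)"
          by (simp add: sum_subtractf)
        also have "\<dots> = (\<Sum>i\<in>S-{k}. c i * u i j)"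
          by (intro sum.cong) (auto simp: u_def algebra_simps)
        finally show ?thesis .
      qed
      have "u i m = 0" for i using k by (simp add: u_def)
      then have "(\<Sum>i\<in>S. d i * v i j) = 0" if "j < Suc m" for j
        unfolding * using c(2) that by (auto simp: less_Suc_eq)
      moreover have "\<exists>i\<in>S. d i \<noteq> 0" using c(1) by (auto simp: d_def)
      ultimately show ?thesis by blast
    qed
  qed
  then show thesis using that by blast
qed

definition weights :: "'i set \<Rightarrow> ('i \<Rightarrow> real) set" where
  "weights S = {w. (\<forall>i\<in>S. 0 \<le> w i) \<and> sum w S = 1}"

text \<open>
  As long as more than \<open>n + 1\<close> points are involved, they satisfy an affine dependence, and moving the
  weights along it until the first one vanishes removes a point.
\<close>

lemma caratheodory:
  fixes v :: "'i \<Rightarrow> nat \<Rightarrow> real"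
  assumes "finite S" "w \<in> weights S"
  obtains T w' where "T \<subseteq> S" "card T \<le> n + 1" "w' \<in> weights T"
    "\<And>j. j < n \<Longrightarrow> (\<Sum>i\<in>T. w' i * v i j) = (\<Sum>i\<in>S. w i * v i j)"
proof -
  have "\<exists>T\<subseteq>S. card T \<le> n + 1 \<and> (\<exists>w'\<in>weights T. \<forall>j<n. (\<Sum>i\<in>T. w' i * v i j) = (\<Sum>i\<in>S. w i * v i j))"
    using assms
  proof (induction "card S" arbitrary: S w rule: less_induct)
    case less
    show ?case
    proof (cases "card S \<le> n + 1")
      case True
      then show ?thesis using less.prems by blast
    next
      case False
      \<comment> \<open>The extra coordinate \<open>1\<close> turns linear into affine dependence.\<close>
      define u where "u i j = (if j < n then v i j else 1)" for i j
      obtain c where c: "\<exists>i\<in>S. c i \<noteq> 0" "\<And>j. j < n + 1 \<Longrightarrow> (\<Sum>i\<in>S. c i * u i j) = 0"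
        using linear_dependence[of S "n + 1" u] less.prems False by auto
      have c0: "sum c S = 0" using c(2)[of n] by (simp add: u_def)
      have cv: "(\<Sum>i\<in>S. c i * v i j) = 0" if "j < n" for j using c(2)[of j] that by (simp add: u_def)
      have w: "\<And>i. i \<in> S \<Longrightarrow> 0 \<le> w i" "sum w S = 1" using less.prems by (auto simp: weights_def)
      define P where "P = {i\<in>S. c i > 0}"
      have "finite P" using less.prems by (simp add: P_def)
      have "P \<noteq> {}"
      proof
        assume "P = {}"
        then have "\<forall>i\<in>S. - c i \<ge> 0" by (auto simp: P_def not_less)
        moreover have "(\<Sum>i\<in>S. - c i) = 0" using c0 by (simp add: sum_negf)
        ultimately have "\<forall>i\<in>S. - c i = 0"
          using sum_nonneg_eq_0_iff[of S "\<lambda>i. - c i"] less.prems by auto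
        then show False using c(1) by auto
      qed
      define t where "t = Min ((\<lambda>i. w i / c i) ` P)"
      have "t \<in> (\<lambda>i. w i / c i) ` P" unfolding t_def using \<open>finite P\<close> \<open>P \<noteq> {}\<close> by (intro Min_in) auto
      then obtain k where k: "k \<in> P" "t = w k / c k" by auto
      have tle: "t \<le> w i / c i" if "i \<in> P" for i
        unfolding t_def using that \<open>finite P\<close> by simp
      have t0: "t \<ge> 0" using k w by (auto simp: P_def)
      define r where "r i = w i - t * c i" for i
      have rk: "r k = 0" using k by (auto simp: r_def P_def)
      have r0: "0 \<le> r i" if "i \<in> S" for i
      proof (cases "c i > 0")
        case True
        then show ?thesis using tle[of i] that by (simp add: P_def r_def pos_le_divide_eq)
      next
        case False
        then have "t * c i \<le> 0" using t0 by (simp add: mult_nonneg_nonpos)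
        then show ?thesis using w(1)[OF that] by (simp add: r_def)
      qed
      have kS: "k \<in> S" using k by (simp add: P_def)
      have drop: "(\<Sum>i\<in>S-{k}. r i * g i) = (\<Sum>i\<in>S. r i * g i)" for g
        using less.prems kS rk by (simp add: sum.remove[of S k])
      have "sum r S = 1"
        by (simp add: r_def sum_subtractf w(2) c0 flip: sum_distrib_left)
      then have rw: "r \<in> weights (S - {k})"
        using r0 drop[of "\<lambda>_. 1"] by (auto simp: weights_def)
      have rv: "(\<Sum>i\<in>S-{k}. r i * v i j) = (\<Sum>i\<in>S. w i * v i j)" if "j < n" for j
      proof -
        have "(\<Sum>i\<in>S. r i * v i j) = (\<Sum>i\<in>S. w i * v i j) - t * (\<Sum>i\<in>S. c i * v i j)"
          by (simp add: r_def algebra_simps sum_subtractf sum_distrib_left)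
        then show ?thesis using cv[OF that] drop[of "\<lambda>i. v i j"] by simp
      qed
      have "card (S - {k}) < card S" using kS less.prems by (intro psubset_card_mono) auto
      from less.hyps[OF this _ rw] less.prems obtain T w' where
        "T \<subseteq> S - {k}" "card T \<le> n + 1" "w' \<in> weights T"
        "\<forall>j<n. (\<Sum>i\<in>T. w' i * v i j) = (\<Sum>i\<in>S-{k}. r i * v i j)" by blast
      then show ?thesis using rv by (intro exI[of _ T]) auto
    qed
  qed
  then show thesis using that by blast
qed

lemma convex_RnD:
  assumes "convex_Rn n T" "x \<in> T" "y \<in> T" "0 \<le> u" "0 \<le> v" "u + v = 1"
  shows "(\<lambda>i\<in>{..<n}. u * x i + v * y i) \<in> T"
  using assms unfolding convex_Rn_def by blast

lemma convex_Rn_weighted_sum: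
  assumes "convex_Rn n T" "finite S" "w \<in> weights S" "\<And>i. i \<in> S \<Longrightarrow> y i \<in> T"
  shows "(\<lambda>j\<in>{..<n}. \<Sum>i\<in>S. w i * y i j) \<in> T"
  using assms(2-4)
proof (induction S arbitrary: w rule: finite_induct)
  case empty
  then show ?case by (simp add: weights_def)
next
  case (insert a S)
  have w: "0 \<le> w a" "\<And>i. i \<in> S \<Longrightarrow> 0 \<le> w i" "w a + sum w S = 1"
    using insert by (auto simp: weights_def)
  have ya: "y a \<in> T" using insert by simp
  have yr: "(\<lambda>j\<in>{..<n}. y a j) = y a"
    using ya assms(1) unfolding convex_Rn_def topspace_product_topology
    by (metis PiE_restrict subsetD topspace_euclidean restrict_def)
  show ?case
  proof (cases "w a = 1")
    case True
    then have "sum w S = 0" using w by simp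
    then have "\<forall>i\<in>S. w i = 0" using w insert by (simp add: sum_nonneg_eq_0_iff)
    then have "(\<lambda>j\<in>{..<n}. \<Sum>i\<in>insert a S. w i * y i j) = (\<lambda>j\<in>{..<n}. y a j)"
      using insert True by (auto simp: fun_eq_iff)
    then show ?thesis using yr ya by simp
  next
    case False
    have "w a \<le> 1" using w sum_nonneg[of S w] by simp
    then have v: "1 - w a > 0" using False by simp
    let ?w = "\<lambda>i. w i / (1 - w a)"
    have sw: "sum w S = 1 - w a" using w by simp
    have ww: "?w \<in> weights S"
      using w v sw by (auto simp: weights_def simp flip: sum_divide_distrib)
    let ?z = "(\<lambda>j\<in>{..<n}. \<Sum>i\<in>S. ?w i * y i j)"
    have z: "?z \<in> T" using insert by (intro insert.IH[OF ww]) auto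
    have "(\<lambda>j\<in>{..<n}. w a * y a j + (1 - w a) * ?z j) \<in> T"
      using w v by (intro convex_RnD[OF assms(1) ya z]) auto
    moreover have "(1 - w a) * (\<Sum>i\<in>S. ?w i * y i j) = (\<Sum>i\<in>S. w i * y i j)" for j
      using v by (simp add: sum_distrib_left)
    then have "(\<lambda>j\<in>{..<n}. w a * y a j + (1 - w a) * ?z j) = (\<lambda>j\<in>{..<n}. \<Sum>i\<in>insert a S. w i * y i j)"
      using insert by (auto simp: fun_eq_iff)
    ultimately show ?thesis by (simp only:)
  qed
qed

lemma weights_indicator: "finite S \<Longrightarrow> i \<in> S \<Longrightarrow> (\<lambda>k. if k = i then 1 else 0) \<in> weights S"
  by (auto simp: weights_def)

lemma convex_Rn_hull_image:
  assumes S: "finite S" and y: "\<And>i. i \<in> S \<Longrightarrow> y i \<in> topspace (Rn n)"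
  shows "convex_Rn n hull (y ` S) = (\<lambda>w. \<lambda>j\<in>{..<n}. \<Sum>i\<in>S. w i * y i j) ` weights S"
proof
  show "(\<lambda>w. \<lambda>j\<in>{..<n}. \<Sum>i\<in>S. w i * y i j) ` weights S \<subseteq> convex_Rn n hull (y ` S)"
    unfolding hull_def using S by (auto intro!: convex_Rn_weighted_sum)
next
  let ?H = "(\<lambda>w. \<lambda>j\<in>{..<n}. \<Sum>i\<in>S. w i * y i j) ` weights S"
  have "y i \<in> ?H" if "i \<in> S" for i
  proof (rule image_eqI[OF _ weights_indicator[OF S that]])
    have "(\<Sum>k\<in>S. (if k = i then 1 else 0) * y k j) = y i j" for j
      using S that by (simp add: if_distrib[of "\<lambda>c. c * _"] cong: if_cong)
    then show "y i = (\<lambda>j\<in>{..<n}. \<Sum>k\<in>S. (if k = i then 1 else 0) * y k j)"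
      using y[OF that] by (auto simp: PiE_iff extensional_def fun_eq_iff)
  qed
  moreover have "convex_Rn n ?H"
    unfolding convex_Rn_def
  proof (intro conjI ballI allI impI)
    show "?H \<subseteq> topspace (Rn n)" by (auto split: if_splits)
  next
    fix p q and u v :: real
    assume "p \<in> ?H" "q \<in> ?H" and uv: "0 \<le> u" "0 \<le> v" "u + v = 1"
    then obtain w w' where w: "w \<in> weights S" "w' \<in> weights S"
      "p = (\<lambda>j\<in>{..<n}. \<Sum>i\<in>S. w i * y i j)" "q = (\<lambda>j\<in>{..<n}. \<Sum>i\<in>S. w' i * y i j)" by auto
    show "(\<lambda>i\<in>{..<n}. u * p i + v * q i) \<in> ?H"
    proof (rule image_eqI)
      show "(\<lambda>i\<in>{..<n}. u * p i + v * q i) = (\<lambda>j\<in>{..<n}. \<Sum>i\<in>S. (u * w i + v * w' i) * y i j)"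
        by (auto simp: w fun_eq_iff algebra_simps sum.distrib sum_distrib_left)
      show "(\<lambda>i. u * w i + v * w' i) \<in> weights S"
        using w uv by (auto simp: weights_def sum.distrib simp flip: sum_distrib_left)
    qed
  qed
  ultimately show "convex_Rn n hull (y ` S) \<subseteq> ?H"
    by (intro hull_minimal) auto
qed

definition sqdist :: "nat \<Rightarrow> (nat \<Rightarrow> real) \<Rightarrow> (nat \<Rightarrow> nat \<Rightarrow> real) \<Rightarrow> nat set \<Rightarrow> (nat \<Rightarrow> real) \<Rightarrow> real" where
  "sqdist n x y S w = (\<Sum>j<n. ((\<Sum>i\<in>S. w i * y i j) - x j)\<^sup>2)"

text \<open>
  The squared distance from \<open>x\<close> to the convex hull of the points \<open>y i\<close> with \<open>i \<in> S\<close>. It is infinite for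
  empty \<open>S\<close>, so that removing points never decreases it.
\<close>

definition hull_gap :: "nat \<Rightarrow> (nat \<Rightarrow> real) \<Rightarrow> (nat \<Rightarrow> nat \<Rightarrow> real) \<Rightarrow> nat set \<Rightarrow> ennreal" where
  "hull_gap n x y S = (INF w\<in>weights S. ennreal (sqdist n x y S w))"

lemma sqdist_nonneg: "0 \<le> sqdist n x y S w"
  by (simp add: sqdist_def sum_nonneg)

lemma hull_gap_le: "w \<in> weights S \<Longrightarrow> hull_gap n x y S \<le> ennreal (sqdist n x y S w)"
  unfolding hull_gap_def by (rule INF_lower)

text \<open>
  The simplex of weights is compact for the product topology, once the weights outside \<open>S\<close> are
  fixed to be \<open>0\<close>.
\<close>

lemma hull_gap_attained:
  assumes S: "finite S" "S \<noteq> {}"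
  obtains w where "w \<in> weights S" "hull_gap n x y S = ennreal (sqdist n x y S w)"
proof -
  define B where "B i = (if i \<in> S then {0..1} else {0::real})" for i
  have "compactin (product_topology (\<lambda>i::nat. euclidean :: real topology) UNIV) (Pi\<^sub>E UNIV B)"
    unfolding compactin_PiE by (auto simp: B_def compactin_euclidean_iff)
  then have "compact (Pi\<^sub>E UNIV B)" by (simp add: euclidean_product_topology compactin_euclidean_iff)
  moreover have cont: "continuous_on UNIV (\<lambda>w::nat \<Rightarrow> real. sum w S)" "continuous_on UNIV (sqdist n x y S)"
    unfolding sqdist_def by (intro continuous_intros continuous_on_product_coordinates)+
  from cont(1) have "closed {w::nat \<Rightarrow> real. sum w S = 1}"
    by (rule closed_Collect_eq) (rule continuous_on_const)
  ultimately have K: "compact (Pi\<^sub>E UNIV B \<inter> {w. sum w S = 1})" (is "compact ?K") by (rule compact_Int_closed)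
  obtain k where k: "k \<in> S" using S by auto
  have "(\<lambda>i. if i = k then 1 else 0) \<in> ?K"
    using weights_indicator[OF S(1) k] k by (auto simp: B_def weights_def PiE_iff)
  then have "?K \<noteq> {}" by blast
  from continuous_attains_inf[OF K this continuous_on_subset[OF cont(2)]]
  obtain w where w: "w \<in> ?K" "\<And>w'. w' \<in> ?K \<Longrightarrow> sqdist n x y S w \<le> sqdist n x y S w'" by auto
  have ww: "w \<in> weights S"
    using w(1) by (auto simp: weights_def B_def PiE_iff) (metis atLeastAtMost_iff)
  have min: "sqdist n x y S w \<le> sqdist n x y S w'" if w': "w' \<in> weights S" for w'
  proof -
    define w'' where "w'' i = (if i \<in> S then w' i else 0)" for i
    have "w' i \<le> 1" if "i \<in> S" for i
      using member_le_sum[of i S w'] w' S that by (auto simp: weights_def)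
    moreover have "sum w'' S = sum w' S" by (intro sum.cong) (auto simp: w''_def)
    ultimately have "w'' \<in> ?K" using w' by (auto simp: weights_def B_def w''_def PiE_iff)
    moreover have "sqdist n x y S w'' = sqdist n x y S w'"
      by (simp add: sqdist_def w''_def cong: sum.cong)
    ultimately show ?thesis using w(2) by metis
  qed
  have "hull_gap n x y S = ennreal (sqdist n x y S w)"
    unfolding hull_gap_def using ww min by (intro antisym INF_lower INF_greatest ennreal_leI) auto
  with ww show thesis by (rule that)
qed

lemma in_hull_iff_hull_gap:
  assumes S: "finite S" "S \<noteq> {}" and y: "\<And>i. i \<in> S \<Longrightarrow> y i \<in> topspace (Rn n)"
    and x: "x \<in> topspace (Rn n)"
  shows "x \<in> convex_Rn n hull (y ` S) \<longleftrightarrow> hull_gap n x y S = 0"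
proof
  assume "x \<in> convex_Rn n hull (y ` S)"
  then obtain w where w: "w \<in> weights S" "x = (\<lambda>j\<in>{..<n}. \<Sum>i\<in>S. w i * y i j)"
    using convex_Rn_hull_image[OF S(1) y] by auto
  then have "sqdist n x y S w = 0" by (simp add: sqdist_def)
  then show "hull_gap n x y S = 0" using hull_gap_le[OF w(1), of n x y] by simp
next
  assume "hull_gap n x y S = 0"
  then obtain w where w: "w \<in> weights S" "ennreal (sqdist n x y S w) = 0"
    using hull_gap_attained[OF S, of n x y] by metis
  then have "sqdist n x y S w = 0" using sqdist_nonneg[of n x y S w] by simp
  then have "\<forall>j<n. (\<Sum>i\<in>S. w i * y i j) = x j"
    by (auto simp: sqdist_def sum_nonneg_eq_0_iff)
  then have "x = (\<lambda>j\<in>{..<n}. \<Sum>i\<in>S. w i * y i j)"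
    using x by (auto simp: PiE_iff extensional_def fun_eq_iff)
  then show "x \<in> convex_Rn n hull (y ` S)"
    using convex_Rn_hull_image[OF S(1) y] w(1) by auto
qed

text \<open>
  The witness is \<open>- z\<close>, where \<open>x + z\<close> is the point of the hull closest to \<open>x\<close>. If \<open>p\<close> lies on the side of
  \<open>x\<close> opposite to \<open>z\<close>, then the segment from \<open>x + z\<close> to \<open>p\<close> comes closer to \<open>x\<close> than its starting point.
\<close>

lemma hull_gap_decreases:
  assumes S: "finite S" "S \<noteq> {}" and k: "k \<notin> S" and pos: "hull_gap n x y S > 0"
  obtains \<theta> where "\<And>p. (\<Sum>j<n. \<theta> j * (p j - x j)) \<ge> 0 \<Longrightarrow> hull_gap n x (y(k := p)) (insert k S) < hull_gap n x y S"
proof -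
  obtain w where w: "w \<in> weights S" "hull_gap n x y S = ennreal (sqdist n x y S w)"
    using hull_gap_attained[OF S] by metis
  define z where "z j = (\<Sum>i\<in>S. w i * y i j) - x j" for j
  define Z where "Z = (\<Sum>j<n. (z j)\<^sup>2)"
  have Z: "sqdist n x y S w = Z" by (simp add: sqdist_def Z_def z_def)
  have Zpos: "Z > 0" using pos unfolding w Z by simp
  have "hull_gap n x (y(k := p)) (insert k S) < hull_gap n x y S"
    if p: "(\<Sum>j<n. - z j * (p j - x j)) \<ge> 0" for p
  proof -
    define Y where "Y = (\<Sum>j<n. (p j - x j)\<^sup>2)"
    have Y: "Y \<ge> 0" by (simp add: Y_def sum_nonneg)
    \<comment> \<open>This minimises the upper bound \<open>(1 - t)\<^sup>2 * Z + t\<^sup>2 * Y\<close> for the new squared distance.\<close>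
    define t where "t = Z / (Z + Y)"
    have t: "0 < t" "t \<le> 1" using Zpos Y by (auto simp: t_def)
    define w' where "w' i = (if i = k then t else (1 - t) * w i)" for i
    have sums: "(\<Sum>i\<in>insert k S. w' i * f i) = t * f k + (1 - t) * (\<Sum>i\<in>S. w i * f i)" for f
    proof -
      have "(\<Sum>i\<in>S. w' i * f i) = (\<Sum>i\<in>S. (1 - t) * w i * f i)"
        using k by (intro sum.cong) (auto simp: w'_def)
      then show ?thesis using S k by (simp add: w'_def sum_distrib_left mult.assoc)
    qed
    have "sum w' (insert k S) = 1" using sums[of "\<lambda>_. 1"] w(1) by (simp add: weights_def)
    then have w': "w' \<in> weights (insert k S)"
      using w(1) t by (auto simp: weights_def w'_def)
    have "(\<Sum>i\<in>insert k S. w' i * (y(k := p)) i j) - x j = (1 - t) * z j + t * (p j - x j)" for j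
    proof -
      have "(\<Sum>i\<in>S. w i * (y(k := p)) i j) = (\<Sum>i\<in>S. w i * y i j)"
        using k by (intro sum.cong) auto
      then show ?thesis using sums[of "\<lambda>i. (y(k := p)) i j"] by (simp add: z_def algebra_simps)
    qed
    then have "sqdist n x (y(k := p)) (insert k S) w' = (\<Sum>j<n. ((1 - t) * z j + t * (p j - x j))\<^sup>2)"
      by (simp add: sqdist_def)
    also have "\<dots> = (\<Sum>j<n. (1 - t)\<^sup>2 * (z j)\<^sup>2 + t\<^sup>2 * (p j - x j)\<^sup>2 - 2 * t * (1 - t) * (- z j * (p j - x j)))"
      by (intro sum.cong refl) (simp add: power2_eq_square algebra_simps)
    also have "\<dots> = (1 - t)\<^sup>2 * Z + t\<^sup>2 * Y - 2 * t * (1 - t) * (\<Sum>j<n. - z j * (p j - x j))"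
      unfolding Z_def Y_def sum_distrib_left by (simp only: sum_subtractf sum.distrib)
    also have "\<dots> \<le> (1 - t)\<^sup>2 * Z + t\<^sup>2 * Y"
    proof -
      have "0 \<le> 2 * t * (1 - t) * (\<Sum>j<n. - z j * (p j - x j))"
        using t by (intro mult_nonneg_nonneg p) auto
      then show ?thesis by linarith
    qed
    also have "\<dots> = Z - t * Z"
    proof -
      have "t * (Z + Y) = Z" using Zpos Y by (simp add: t_def)
      then have "t * (t * (Z + Y)) = t * Z" by simp
      then show ?thesis by (simp add: power2_eq_square algebra_simps)
    qed
    also have "\<dots> < Z" using t Zpos by simp
    finally have "ennreal (sqdist n x (y(k := p)) (insert k S) w') < ennreal Z"
      using Zpos by (simp add: ennreal_lessI)
    then show ?thesis
      using hull_gap_le[OF w', of n x "y(k := p)"] w Z by (metis le_less_trans)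
  qed
  then show thesis by (rule that)
qed

lemma hull_gap_mono_weights:
  assumes "finite S" "T \<subseteq> S" "w \<in> weights T"
    and eq: "\<And>j. j < n \<Longrightarrow> (\<Sum>i\<in>T. w i * y i j) = z j"
  shows "hull_gap n x y S \<le> ennreal (\<Sum>j<n. (z j - x j)\<^sup>2)"
proof -
  define w' where "w' i = (if i \<in> T then w i else 0)" for i
  have *: "(\<Sum>i\<in>S. w' i * f i) = (\<Sum>i\<in>T. w i * f i)" for f
    using assms by (intro sum.mono_neutral_cong_right) (auto simp: w'_def)
  have "w' \<in> weights S"
    using *[of "\<lambda>_. 1"] assms by (auto simp: weights_def w'_def)
  from hull_gap_le[OF this, of n x y] show ?thesis
    using eq by (simp add: sqdist_def *)
qed

lemma hull_gap_antimono:
  assumes "finite S" "T \<subseteq> S"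
  shows "hull_gap n x y S \<le> hull_gap n x y T"
  unfolding hull_gap_def[of n x y T]
  by (rule INF_greatest) (auto simp: sqdist_def intro!: hull_gap_mono_weights[OF assms])

text \<open>
  The closest point of the hull is a convex combination of at most \<open>n + 1\<close> of the points, and it
  remains available when any other point is removed.
\<close>

lemma card_essential_points_le:
  assumes S: "finite S"
  shows "card {i\<in>S. hull_gap n x y S < hull_gap n x y (S - {i})} \<le> n + 1"
proof (cases "S = {}")
  case False
  obtain w where w: "w \<in> weights S" "hull_gap n x y S = ennreal (sqdist n x y S w)"
    using hull_gap_attained[OF S False] by metis
  obtain T w' where T: "T \<subseteq> S" "card T \<le> n + 1" "w' \<in> weights T"
    "\<And>j. j < n \<Longrightarrow> (\<Sum>i\<in>T. w' i * y i j) = (\<Sum>i\<in>S. w i * y i j)"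
    using caratheodory[OF S w(1), of n y] by metis
  have "hull_gap n x y (S - {i}) \<le> hull_gap n x y S" if "i \<in> S - T" for i
    using hull_gap_mono_weights[of "S - {i}" T w' n y "\<lambda>j. \<Sum>i\<in>S. w i * y i j" x] that T S w
    by (auto simp: sqdist_def)
  then have "{i\<in>S. hull_gap n x y S < hull_gap n x y (S - {i})} \<subseteq> T" by (auto simp: not_less[symmetric])
  then have "card {i\<in>S. hull_gap n x y S < hull_gap n x y (S - {i})} \<le> card T"
    using T S by (intro card_mono) (auto intro: finite_subset)
  then show ?thesis using T by simp
qed simp

text \<open>
  Weights with rational values are dense in the simplex; this makes the distance to the hull of
  random points measurable. Normalised natural numbers satisfy the constraint that the weights
  sum to \<open>1\<close>, and \<open>nat \<lfloor>m * w i\<rfloor>\<close> normalised converges to \<open>w i\<close>.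
\<close>

lemma hull_gap_countable:
  assumes S: "finite S"
  shows "hull_gap n x y S = (INF k\<in>{k \<in> S \<rightarrow>\<^sub>E (UNIV :: nat set). sum k S \<noteq> 0}.
    ennreal (sqdist n x y S (\<lambda>i. real (k i) / real (sum k S))))" (is "_ = ?I")
proof (rule antisym)
  show "hull_gap n x y S \<le> ?I"
  proof (rule INF_greatest, rule hull_gap_le)
    fix k :: "nat \<Rightarrow> nat" assume "k \<in> {k \<in> S \<rightarrow>\<^sub>E UNIV. sum k S \<noteq> 0}"
    then have "real (sum k S) \<noteq> 0" by (metis (mono_tags, lifting) mem_Collect_eq of_nat_eq_0_iff)
    then have "(\<Sum>i\<in>S. real (k i) / real (sum k S)) = 1"
      unfolding sum_divide_distrib[symmetric] of_nat_sum[symmetric] by (rule divide_self)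
    then show "(\<lambda>i. real (k i) / real (sum k S)) \<in> weights S"
      unfolding weights_def by (auto simp: sum_nonneg)
  qed
next
  show "?I \<le> hull_gap n x y S"
    unfolding hull_gap_def
  proof (rule INF_greatest)
    fix w assume w: "w \<in> weights S"
    define k where "k m = (\<lambda>i\<in>S. nat \<lfloor>real m * w i\<rfloor>)" for m
    have lim: "(\<lambda>m. real (k m i) / real m) \<longlonglongrightarrow> w i" if "i \<in> S" for i
    proof -
      have wi: "w i \<ge> 0" using w that by (simp add: weights_def)
      have r: "real (k m i) = of_int \<lfloor>real m * w i\<rfloor>" for m
        using that wi by (simp add: k_def)
      show ?thesis
      proof (rule tendsto_sandwich)
        show "\<forall>\<^sub>F m in sequentially. w i - 1 / real m \<le> real (k m i) / real m"
          using eventually_gt_at_top[of 0]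
        proof eventually_elim
          case (elim m)
          have "real m * w i - 1 \<le> real (k m i)" unfolding r by linarith
          then have "(real m * w i - 1) / real m \<le> real (k m i) / real m"
            by (rule divide_right_mono) simp
          then show ?case using elim by (simp add: diff_divide_distrib)
        qed
        show "\<forall>\<^sub>F m in sequentially. real (k m i) / real m \<le> w i"
          using eventually_gt_at_top[of 0]
        proof eventually_elim
          case (elim m)
          have "real (k m i) \<le> real m * w i" unfolding r by linarith
          then show ?case using elim by (simp add: pos_divide_le_eq mult.commute)
        qed
        show "(\<lambda>m. w i - 1 / real m) \<longlonglongrightarrow> w i"
          using tendsto_diff[OF tendsto_const[of "w i"] lim_1_over_n] by simp
      qed simp
    qed
    have "(\<lambda>m. \<Sum>i\<in>S. real (k m i) / real m) \<longlonglongrightarrow> (\<Sum>i\<in>S. w i)"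
      by (intro tendsto_sum lim)
    then have limS: "(\<lambda>m. real (sum (k m) S) / real m) \<longlonglongrightarrow> 1"
      using w by (simp add: weights_def flip: sum_divide_distrib)
    have limr: "(\<lambda>m. real (k m i) / real (sum (k m) S)) \<longlonglongrightarrow> w i" if "i \<in> S" for i
    proof (rule Lim_transform_eventually)
      show "(\<lambda>m. (real (k m i) / real m) / (real (sum (k m) S) / real m)) \<longlonglongrightarrow> w i"
        using tendsto_divide[OF lim[OF that] limS] by simp
      show "\<forall>\<^sub>F m in sequentially. (real (k m i) / real m) / (real (sum (k m) S) / real m) = real (k m i) / real (sum (k m) S)"
        using eventually_gt_at_top[of 0] by eventually_elim simp
    qed
    have "(\<lambda>m. sqdist n x y S (\<lambda>i. real (k m i) / real (sum (k m) S))) \<longlonglongrightarrow> sqdist n x y S w"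
      unfolding sqdist_def by (intro tendsto_intros limr)
    then have lime: "(\<lambda>m. ennreal (sqdist n x y S (\<lambda>i. real (k m i) / real (sum (k m) S)))) \<longlonglongrightarrow> ennreal (sqdist n x y S w)"
      by (rule tendsto_ennrealI)
    have "\<forall>\<^sub>F m in sequentially. real (sum (k m) S) / real m > 0"
      using order_tendstoD(1)[OF limS, of 0] by simp
    then have "\<forall>\<^sub>F m in sequentially. ?I \<le> ennreal (sqdist n x y S (\<lambda>i. real (k m i) / real (sum (k m) S)))"
    proof eventually_elim
      case (elim m)
      then have "sum (k m) S \<noteq> 0" by (metis div_0 less_irrefl of_nat_0)
      then show ?case by (intro INF_lower2[of "k m"]) (auto simp: k_def)
    qed
    then show "?I \<le> ennreal (sqdist n x y S w)"
      by (intro tendsto_lowerbound[OF lime]) auto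
  qed
qed

section \<open>Sample size in terms of half-space depth\<close>

lemma hull_gap_measurable:
  assumes S: "finite S" "S \<subseteq> I" and M: "sets M = sets (lborel_Rn n)"
  shows "(\<lambda>y. hull_gap n x y S) \<in> borel_measurable (PiM I (\<lambda>_. M))"
proof -
  have [measurable]: "(\<lambda>y. y i j) \<in> borel_measurable (PiM I (\<lambda>_. M))" if "i \<in> S" "j < n" for i j
  proof -
    have "(\<lambda>p. p j) \<in> borel_measurable M"
      using that unfolding measurable_cong_sets[OF M refl]
      by (intro measurable_component_singleton[of j "{..<n}" "\<lambda>_. lborel", simplified measurable_lborel1]) auto
    moreover have "(\<lambda>y. y i) \<in> measurable (PiM I (\<lambda>_. M)) M"
      using that S by (intro measurable_component_singleton) auto
    ultimately show ?thesis by (rule measurable_compose[rotated])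
  qed
  have "countable {k \<in> S \<rightarrow>\<^sub>E (UNIV :: nat set). sum k S \<noteq> 0}"
    by (rule countable_subset[OF _ countable_PiE[OF S(1)]]) auto
  then show ?thesis
    unfolding hull_gap_countable[OF S(1)] sqdist_def
    by (intro borel_measurable_INF measurable_compose[OF _ measurable_ennreal]
        borel_measurable_sum borel_measurable_power borel_measurable_diff borel_measurable_times) auto
qed

lemma hull_gap_cong:
  assumes "\<And>i. i \<in> S \<Longrightarrow> y i = y' i"
  shows "hull_gap n x y S = hull_gap n x y' S"
  unfolding hull_gap_def sqdist_def using assms by (simp cong: sum.cong)

text \<open>
  Double counting of the pairs of a sample and an essential index \<open>i\<close>, that is, one whose removal
  increases the distance to the hull. Every sample has at most \<open>n + 1\<close> essential indices. For fixed \<open>i\<close>,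
  integrate over the \<open>i\<close>-th point last: if the hull of the others misses \<open>x\<close>, then \<open>i\<close> is essential with
  conditional probability at least the depth \<open>\<alpha>\<close>. Since removing a point enlarges the event that the
  hull misses \<open>x\<close>, the probability of that event for the full sample bounds the one for the others
  from below.
\<close>

lemma prob_not_in_hull_le:
  fixes \<alpha> :: real
  assumes "prob_space M" and M: "sets M = sets (lborel_Rn n)" and \<alpha>: "0 \<le> \<alpha>"
    and depth: "\<And>\<theta>. ennreal \<alpha> \<le> emeasure M {p\<in>space M. 0 \<le> (\<Sum>j<n. \<theta> j * (p j - x j))}"
    and N: "N \<ge> 2"
  shows "of_nat N * (ennreal \<alpha> * emeasure (PiM {..<N} (\<lambda>_. M)) {y \<in> space (PiM {..<N} (\<lambda>_. M)). hull_gap n x y {..<N} > 0})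
    \<le> of_nat (n + 1)"
proof -
  interpret M: prob_space M by fact
  interpret F: product_sigma_finite "\<lambda>_::nat. M" by unfold_locales
  let ?I = "{..<N}"
  let ?P = "PiM ?I (\<lambda>_. M)"
  interpret P: prob_space ?P by (rule prob_space_PiM) unfold_locales
  define J where "J i = {y \<in> space ?P. hull_gap n x y ?I < hull_gap n x y (?I - {i})}" for i
  define E where "E i = {y \<in> space ?P. 0 < hull_gap n x y (?I - {i})}" for i
  have [measurable]: "(\<lambda>y. hull_gap n x y ?I) \<in> borel_measurable ?P"
    "(\<lambda>y. hull_gap n x y (?I - {i})) \<in> borel_measurable ?P" for i
    by (auto intro!: hull_gap_measurable M)
  have [measurable]: "J i \<in> sets ?P" "E i \<in> sets ?P" for i
    unfolding J_def E_def by measurable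
  have "ennreal \<alpha> * emeasure ?P {y \<in> space ?P. hull_gap n x y ?I > 0} \<le> emeasure ?P (J i)" if i: "i \<in> ?I" for i
  proof -
    let ?Q = "PiM (?I - {i}) (\<lambda>_. M)"
    have ins: "insert i (?I - {i}) = ?I" using i by auto
    have fold: "emeasure ?P A = (\<integral>\<^sup>+y. (\<integral>\<^sup>+p. indicator A (y(i := p)) \<partial>M) \<partial>?Q)"
      if "A \<in> sets ?P" for A
    proof -
      have "emeasure ?P A = (\<integral>\<^sup>+y. indicator A y \<partial>(PiM (insert i (?I - {i})) (\<lambda>_. M)))"
        using that unfolding ins by simp
      also have "\<dots> = (\<integral>\<^sup>+y. (\<integral>\<^sup>+p. indicator A (y(i := p)) \<partial>M) \<partial>?Q)"
        using that by (intro F.product_nn_integral_insert) (simp_all add: ins del: insert_Diff_single)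
      finally show ?thesis .
    qed
    have "emeasure ?P {y \<in> space ?P. hull_gap n x y ?I > 0} \<le> emeasure ?P (E i)"
      by (intro emeasure_mono) (auto simp: E_def intro: less_le_trans hull_gap_antimono)
    then have "ennreal \<alpha> * emeasure ?P {y \<in> space ?P. hull_gap n x y ?I > 0} \<le> ennreal \<alpha> * emeasure ?P (E i)"
      by (rule mult_left_mono) simp
    also have "\<dots> = (\<integral>\<^sup>+y. ennreal \<alpha> * (\<integral>\<^sup>+p. indicator (E i) (y(i := p)) \<partial>M) \<partial>?Q)"
    proof -
      have "(\<lambda>(y, p). y(i := p)) \<in> measurable (PiM (?I - {i}) (\<lambda>_. M) \<Otimes>\<^sub>M M) ?P"
        using measurable_add_dim[of i "?I - {i}" "\<lambda>_. M"] unfolding ins .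
      from measurable_compose[OF this borel_measurable_indicator[of "E i"]]
      have "(\<lambda>y. \<integral>\<^sup>+p. indicator (E i) (y(i := p)) \<partial>M) \<in> borel_measurable (PiM (?I - {i}) (\<lambda>_. M))"
        by (intro M.borel_measurable_nn_integral) (simp add: case_prod_beta')
      then show ?thesis
        unfolding fold[OF \<open>E i \<in> sets ?P\<close>] by (rule nn_integral_cmult[symmetric])
    qed
    also have "\<dots> \<le> (\<integral>\<^sup>+y. (\<integral>\<^sup>+p. indicator (J i) (y(i := p)) \<partial>M) \<partial>?Q)"
    proof (rule nn_integral_mono)
      fix y assume y: "y \<in> space (PiM (?I - {i}) (\<lambda>_. M))"
      have sp: "y(i := p) \<in> space ?P" if "p \<in> space M" for p
        using y that i by (auto simp: space_PiM PiE_iff extensional_def)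
      have gap: "hull_gap n x (y(i := p)) (?I - {i}) = hull_gap n x y (?I - {i})" for p
        by (rule hull_gap_cong) auto
      show "ennreal \<alpha> * (\<integral>\<^sup>+p. indicator (E i) (y(i := p)) \<partial>M) \<le> (\<integral>\<^sup>+p. indicator (J i) (y(i := p)) \<partial>M)"
      proof (cases "hull_gap n x y (?I - {i}) > 0")
        case False
        then have "indicator (E i) (y(i := p)) = (0::ennreal)" for p by (auto simp: E_def gap indicator_def)
        then show ?thesis by simp
      next
        case True
        \<comment> \<open>The other points have a hull with a point closest to \<open>x\<close> only if there is at least one of them.\<close>
        have "card (?I - {i}) \<ge> 1" using i N by simp
        then have ne: "?I - {i} \<noteq> {}" by (metis card.empty not_one_le_zero)
        obtain \<theta> where \<theta>: "\<And>p. (\<Sum>j<n. \<theta> j * (p j - x j)) \<ge> 0 \<Longrightarrow>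
          hull_gap n x (y(i := p)) (insert i (?I - {i})) < hull_gap n x y (?I - {i})"
          using hull_gap_decreases[OF _ ne _ True, of i] by auto
        let ?H = "{p\<in>space M. 0 \<le> (\<Sum>j<n. \<theta> j * (p j - x j))}"
        have "(\<integral>\<^sup>+p. indicator (E i) (y(i := p)) \<partial>M) \<le> (\<integral>\<^sup>+p. 1 \<partial>M)"
          by (intro nn_integral_mono) (auto simp: indicator_def)
        then have "ennreal \<alpha> * (\<integral>\<^sup>+p. indicator (E i) (y(i := p)) \<partial>M) \<le> ennreal \<alpha> * 1"
          by (intro mult_left_mono) (simp_all add: M.emeasure_space_1)
        also have "\<dots> \<le> emeasure M ?H" using depth[of \<theta>] by simp
        also have "\<dots> = (\<integral>\<^sup>+p. indicator ?H p \<partial>M)"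
        proof -
          have "(\<lambda>p. p j) \<in> borel_measurable M" if "j < n" for j
            using that unfolding measurable_cong_sets[OF M refl]
            by (intro measurable_component_singleton[of j "{..<n}" "\<lambda>_. lborel", simplified measurable_lborel1]) auto
          then have "(\<lambda>p. \<Sum>j<n. \<theta> j * (p j - x j)) \<in> borel_measurable M" by measurable
          then have "?H \<in> sets M" by measurable
          then show ?thesis by simp
        qed
        also have "\<dots> \<le> (\<integral>\<^sup>+p. indicator (J i) (y(i := p)) \<partial>M)"
          using \<theta> sp ins by (intro nn_integral_mono) (auto simp: indicator_def J_def gap)
        finally show ?thesis .
      qed
    qed
    also have "\<dots> = emeasure ?P (J i)" by (rule fold[symmetric]) measurable
    finally show ?thesis .
  qed
  then have "of_nat N * (ennreal \<alpha> * emeasure ?P {y \<in> space ?P. hull_gap n x y ?I > 0}) \<le> (\<Sum>i<N. emeasure ?P (J i))"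
    using sum_mono[of ?I "\<lambda>_. ennreal \<alpha> * emeasure ?P {y \<in> space ?P. hull_gap n x y ?I > 0}" "\<lambda>i. emeasure ?P (J i)"]
    by simp
  also have "\<dots> = (\<integral>\<^sup>+y. (\<Sum>i<N. indicator (J i) y) \<partial>?P)"
    by (subst nn_integral_sum) auto
  also have "\<dots> \<le> (\<integral>\<^sup>+y. of_nat (n + 1) \<partial>?P)"
  proof (rule nn_integral_mono)
    fix y assume "y \<in> space ?P"
    then have "(\<Sum>i<N. indicator (J i) y :: ennreal) = of_nat (card {i\<in>?I. hull_gap n x y ?I < hull_gap n x y (?I - {i})})"
      by (simp add: J_def indicator_def sum.If_cases Int_def)
    also have "\<dots> \<le> of_nat (n + 1)"
      by (rule of_nat_mono[OF card_essential_points_le]) simp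
    finally show "(\<Sum>i<N. indicator (J i) y :: ennreal) \<le> of_nat (n + 1)" .
  qed
  also have "\<dots> = of_nat (n + 1)" by (simp add: P.emeasure_space_1)
  finally show ?thesis .
qed

text \<open>
  For \<open>N \<ge> 2 (n + 1) / \<alpha>\<close> the bound \<open>(n + 1) / (N * \<alpha>)\<close> on the probability of missing \<open>x\<close> is at most
  \<open>1/2\<close>.
\<close>

lemma median_threshold_le_depth:
  fixes \<alpha> :: real
  assumes prob: "prob_space M" and M: "sets M = sets (lborel_Rn n)" and \<alpha>: "0 < \<alpha>"
    and depth: "\<And>\<theta>. ennreal \<alpha> \<le> emeasure M {p\<in>space M. 0 \<le> (\<Sum>j<n. \<theta> j * (p j - x j))}"
    and x: "x \<in> topspace (Rn n)"
  shows "median_threshold n M x \<le> enat (nat \<lceil>2 * real (n + 1) / \<alpha>\<rceil>)"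
proof -
  interpret M: prob_space M by fact
  interpret U: product_prob_space "\<lambda>_::nat. M" UNIV by unfold_locales
  define N where "N = nat \<lceil>2 * real (n + 1) / \<alpha>\<rceil>"
  have "ennreal \<alpha> \<le> 1" using depth[of "\<lambda>_. 0"] M.emeasure_le_1 by (rule order_trans)
  then have "\<alpha> \<le> 1" by simp
  have N1: "2 * real (n + 1) / \<alpha> \<le> real N" unfolding N_def by linarith
  have "2 * real (n + 1) \<le> 2 * real (n + 1) / \<alpha>"
    using \<alpha> \<open>\<alpha> \<le> 1\<close> by (simp add: pos_le_divide_eq mult_left_le)
  then have "2 * real (n + 1) \<le> real N" using N1 by (rule order_trans)
  then have N2: "N \<ge> 2" by simp
  let ?I = "{..<N}"
  let ?P = "PiM ?I (\<lambda>_. M)" and ?U = "PiM (UNIV :: nat set) (\<lambda>_. M)"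
  interpret P: prob_space ?P by (rule prob_space_PiM) unfold_locales
  have mP: "(\<lambda>y. hull_gap n x y ?I) \<in> borel_measurable ?P"
    and mU: "(\<lambda>y. hull_gap n x y ?I) \<in> borel_measurable ?U"
    by (auto intro!: hull_gap_measurable M)
  let ?B = "{y \<in> space ?P. hull_gap n x y ?I > 0}"
  have B: "?B \<in> sets ?P" using mP by measurable
  have "of_nat N * (ennreal \<alpha> * emeasure ?P ?B) \<le> of_nat (n + 1)"
    using prob_not_in_hull_le[OF prob M _ depth N2] \<alpha> by simp
  then have "ennreal (real N * (\<alpha> * P.prob ?B)) \<le> ennreal (real (n + 1))"
    using \<alpha> by (simp only: P.emeasure_eq_measure ennreal_of_nat_eq_real_of_nat ennreal_mult measure_nonneg of_nat_0_le_iff less_imp_le mult_nonneg_nonneg)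
  then have "real N * \<alpha> * P.prob ?B \<le> real (n + 1)"
    by (subst (asm) ennreal_le_iff) (simp_all add: mult.assoc)
  moreover have "2 * real (n + 1) \<le> real N * \<alpha>" using N1 \<alpha> by (simp add: pos_divide_le_eq)
  then have "2 * real (n + 1) * P.prob ?B \<le> real N * \<alpha> * P.prob ?B"
    by (rule mult_right_mono) simp
  ultimately have "2 * real (n + 1) * P.prob ?B \<le> real (n + 1)" by linarith
  then have "real (n + 1) * (2 * P.prob ?B) \<le> real (n + 1) * 1" by (simp only: mult_1_right mult.assoc mult.left_commute)
  then have "2 * P.prob ?B \<le> 1" by (rule mult_left_le_imp_le) simp
  then have "P.prob ?B \<le> 1 / 2" by simp
  moreover have "U.prob {y \<in> space ?U. hull_gap n x y ?I > 0} = P.prob ?B"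
  proof -
    have "P.prob ?B = measure (distr ?U ?P (\<lambda>y. restrict y ?I)) ?B"
      by (simp add: U.distr_PiM_restrict_finite)
    also have "\<dots> = U.prob ((\<lambda>y. restrict y ?I) -` ?B \<inter> space ?U)"
      using B by (intro measure_distr measurable_restrict_subset) auto
    also have "(\<lambda>y. restrict y ?I) -` ?B \<inter> space ?U = {y \<in> space ?U. hull_gap n x y ?I > 0}"
    proof -
      have "hull_gap n x (restrict y ?I) ?I = hull_gap n x y ?I" for y
        by (rule hull_gap_cong) auto
      then show ?thesis by (auto simp: space_PiM)
    qed
    finally show ?thesis by simp
  qed
  moreover have "{y \<in> space ?U. x \<in> convex_Rn n hull (y ` ?I)} = space ?U - {y \<in> space ?U. hull_gap n x y ?I > 0}"
  proof -
    have spM: "space M = topspace (Rn n)" using sets_eq_imp_space_eq[OF M] by (simp add: space_PiM)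
    have "x \<in> convex_Rn n hull (y ` ?I) \<longleftrightarrow> hull_gap n x y ?I = 0" if "y \<in> space ?U" for y
      by (rule in_hull_iff_hull_gap) (use that N2 x spM in \<open>auto simp: space_PiM lessThan_empty_iff\<close>)
    then show ?thesis by (auto simp: zero_less_iff_neq_zero)
  qed
  moreover have "{y \<in> space ?U. hull_gap n x y ?I > 0} \<in> sets ?U" using mU by measurable
  ultimately have "U.prob {y \<in> space ?U. x \<in> convex_Rn n hull (y ` ?I)} \<ge> 1 / 2"
    by (simp add: U.prob_compl)
  then show ?thesis unfolding median_threshold_def N_def[symmetric]
    by (intro INF_lower) simp
qed

section \<open>Exponential moments of variables with a root-concave tail\<close>

text \<open>
  The quotient \<open>n! * (e / n) ^ n / sqrt n\<close> equals \<open>e\<close> for \<open>n = 1\<close> and decreases, which amounts to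
  \<open>1 \<le> (n + 1/2) * ln ((n + 1) / n)\<close>.
\<close>

lemma fact_le_Stirling:
  assumes "n \<ge> 1"
  shows "fact n * exp (real n) \<le> exp 1 * sqrt (real n) * real n ^ n"
  using assms
proof (induction n rule: nat_induct_at_least)
  case (Suc n)
  define m where "m = real n"
  have m: "m \<ge> 1" using Suc.hyps by (simp add: m_def)
  have powexp: "sqrt y * y ^ n = exp ((m + 1/2) * ln y)" if "y > 0" for y
  proof -
    have "y ^ n = exp (m * ln y)" using that by (simp add: m_def exp_of_nat_mult)
    moreover have "sqrt y = exp (ln y / 2)" using that by (simp flip: ln_sqrt)
    ultimately show ?thesis by (simp add: algebra_simps flip: exp_add)
  qed
  have "2 * (m + 1 - m) / (m + (m + 1)) \<le> ln (m + 1) - ln m"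
    using m by (intro ln_inverse_approx_ge) auto
  then have "1 \<le> (m + 1/2) * (ln (m + 1) - ln m)"
    using m by (simp add: field_simps)
  then have "1 + (m + 1/2) * ln m \<le> (m + 1/2) * ln (m + 1)" by (simp add: algebra_simps)
  then have "exp (1 + (m + 1/2) * ln m) \<le> exp ((m + 1/2) * ln (m + 1))" by simp
  then have *: "exp 1 * (sqrt m * m ^ n) \<le> sqrt (m + 1) * (m + 1) ^ n"
    using m by (simp add: powexp exp_add)
  have "fact (Suc n) * exp (real (Suc n)) = (m + 1) * exp 1 * (fact n * exp m)"
    by (simp add: m_def exp_add algebra_simps)
  also have "\<dots> \<le> (m + 1) * exp 1 * (exp 1 * sqrt m * m ^ n)"
    using Suc.IH m by (intro mult_left_mono) (auto simp: m_def)
  also have "\<dots> = (m + 1) * exp 1 * (exp 1 * (sqrt m * m ^ n))" by simp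
  also have "\<dots> \<le> (m + 1) * exp 1 * (sqrt (m + 1) * (m + 1) ^ n)"
    using * m by (intro mult_left_mono) auto
  also have "\<dots> = exp 1 * sqrt (real (Suc n)) * real (Suc n) ^ Suc n"
    by (simp add: m_def algebra_simps)
  finally show ?case .
qed simp

lemma nn_integral_reflect_scale:
  fixes f :: "real \<Rightarrow> ennreal" and a s :: real
  assumes [measurable]: "f \<in> borel_measurable borel" and s: "s > 0"
  shows "(\<integral>\<^sup>+u. f u \<partial>lborel) = ennreal (1 / s) * (\<integral>\<^sup>+w. f (a - w / s) \<partial>lborel)"
  using nn_integral_real_affine[of f "- 1 / s" a] s by simp

text \<open>
  The substitution \<open>u = a - w / s\<close> turns this into the Gamma integral for \<open>n!\<close>.
\<close>

lemma nn_integral_power_exp_to: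
  fixes a g s :: real
  assumes s: "s > 0" and g: "g \<ge> 0"
  shows "(\<integral>\<^sup>+u. ennreal (s * exp (s * u) * (g * (a - u)) ^ n) * indicator {..a} u \<partial>lborel)
    = ennreal (exp (s * a) * (g / s) ^ n * fact n)"
proof -
  have *: "ennreal (s * exp (s * (a - w / s)) * (g * (a - (a - w / s))) ^ n) * indicator {..a} (a - w / s)
     = ennreal (s * exp (s * a) * (g / s) ^ n) * (ennreal (w ^ n * exp (- w)) * indicator {0..} w)" for w
  proof (cases "w \<ge> 0")
    case True
    have "s * exp (s * (a - w / s)) * (g * (a - (a - w / s))) ^ n = s * exp (s * a) * (g / s) ^ n * (w ^ n * exp (- w))"
    proof -
      have "s * (a - w / s) = s * a - w" "g * (a - (a - w / s)) = g / s * w" using s by (simp_all add: right_diff_distrib)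
      then show ?thesis by (simp only: exp_diff exp_minus power_mult_distrib divide_inverse mult.assoc mult.left_commute mult.commute)
    qed
    then have "ennreal (s * exp (s * (a - w / s)) * (g * (a - (a - w / s))) ^ n)
        = ennreal (s * exp (s * a) * (g / s) ^ n * (w ^ n * exp (- w)))" by (simp only:)
    also have "\<dots> = ennreal (s * exp (s * a) * (g / s) ^ n) * ennreal (w ^ n * exp (- w))"
      using True s g by (intro ennreal_mult) auto
    finally have "ennreal (s * exp (s * (a - w / s)) * (g * (a - (a - w / s))) ^ n)
        = ennreal (s * exp (s * a) * (g / s) ^ n) * ennreal (w ^ n * exp (- w))" .
    moreover have "indicator {..a} (a - w / s) = (1::ennreal)" "indicator {0..} w = (1::ennreal)"
      using True s by simp_all
    ultimately show ?thesis by (simp only: mult_1_right)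
  qed (use s in \<open>auto simp: indicator_def zero_le_divide_iff\<close>)
  have "(\<integral>\<^sup>+u. ennreal (s * exp (s * u) * (g * (a - u)) ^ n) * indicator {..a} u \<partial>lborel)
     = ennreal (1 / s) * (\<integral>\<^sup>+w. ennreal (s * exp (s * a) * (g / s) ^ n) * (ennreal (w ^ n * exp (- w)) * indicator {0..} w) \<partial>lborel)"
    by (subst nn_integral_reflect_scale[where a = a, OF _ s]) (simp_all only: *, measurable)
  also have "\<dots> = ennreal (1 / s) * (ennreal (s * exp (s * a) * (g / s) ^ n) * ennreal (fact n))"
    by (subst nn_integral_cmult) (simp_all add: nn_intergal_power_times_exp_Ici)
  also have "\<dots> = ennreal (exp (s * a) * (g / s) ^ n * fact n)"
    using s g by (simp flip: ennreal_mult)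
  finally show ?thesis .
qed

lemma (in prob_space) nn_integral_exp_eq_tail:
  fixes s :: real
  assumes [measurable]: "Y \<in> borel_measurable M" and s: "s > 0"
  shows "(\<integral>\<^sup>+p. ennreal (exp (s * Y p)) \<partial>M)
    = (\<integral>\<^sup>+u. ennreal (s * exp (s * u)) * emeasure M {p\<in>space M. u \<le> Y p} \<partial>lborel)"
proof -
  interpret pair_sigma_finite M lborel ..
  have "ennreal (exp (s * y)) = (\<integral>\<^sup>+u. ennreal (s * exp (s * u)) * indicator {..y} u \<partial>lborel)" for y
    using nn_integral_power_exp_to[OF s, of 1 y 0] by simp
  then have "(\<integral>\<^sup>+p. ennreal (exp (s * Y p)) \<partial>M)
    = (\<integral>\<^sup>+p. (\<integral>\<^sup>+u. ennreal (s * exp (s * u)) * indicator {..Y p} u \<partial>lborel) \<partial>M)" by simp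
  also have "\<dots> = (\<integral>\<^sup>+u. (\<integral>\<^sup>+p. ennreal (s * exp (s * u)) * indicator {..Y p} u \<partial>M) \<partial>lborel)"
    by (rule Fubini'[symmetric]) (simp add: indicator_def)
  also have "\<dots> = (\<integral>\<^sup>+u. ennreal (s * exp (s * u)) * emeasure M {p\<in>space M. u \<le> Y p} \<partial>lborel)"
  proof (rule nn_integral_cong)
    fix u
    have "(\<integral>\<^sup>+p. ennreal (s * exp (s * u)) * indicator {..Y p} u \<partial>M)
        = (\<integral>\<^sup>+p. ennreal (s * exp (s * u)) * indicator {p\<in>space M. u \<le> Y p} p \<partial>M)"
      by (intro nn_integral_cong) (auto simp: indicator_def)
    then show "(\<integral>\<^sup>+p. ennreal (s * exp (s * u)) * indicator {..Y p} u \<partial>M)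
        = ennreal (s * exp (s * u)) * emeasure M {p\<in>space M. u \<le> Y p}"
      by (simp add: nn_integral_cmult)
  qed
  finally show ?thesis .
qed

text \<open>
  A supporting line at \<open>0\<close> for a function that is concave where it is positive. Its slope is the
  supremum of the slopes of the chords from the left, which is finite because the chord from \<open>0\<close> to \<open>v0\<close>
  bounds them.
\<close>

lemma concave_tail_tangent:
  fixes G :: "real \<Rightarrow> real"
  assumes anti: "\<And>u v. u \<le> v \<Longrightarrow> G v \<le> G u"
    and conc: "\<And>u v t. 0 < G u \<Longrightarrow> 0 < G v \<Longrightarrow> 0 < t \<Longrightarrow> t < 1 \<Longrightarrow>
       (1 - t) * G u + t * G v \<le> G ((1 - t) * u + t * v)"
    and v0: "v0 > 0" "G v0 > 0"
  obtains g where "g \<ge> 0" "\<And>u. 0 < G u \<Longrightarrow> G u \<le> G 0 - g * u"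
proof -
  have slope: "(G u - G 0) / (- u) \<le> (G 0 - G v) / v" if uv: "u < 0" "0 < v" "G v > 0" for u v
  proof -
    define t where "t = - u / (v - u)"
    have t: "0 < t" "t < 1" unfolding t_def using uv by (simp_all only: zero_less_divide_iff divide_less_eq_1) auto
    have t1: "1 - t = v / (v - u)" using uv by (simp add: t_def field_simps)
    have "G u > 0" using anti[of u v] uv by simp
    from conc[OF this uv(3) t] have "(1 - t) * G u + t * G v \<le> G ((1 - t) * u + t * v)" .
    moreover have "(1 - t) * u + t * v = 0" unfolding t1 using uv by (simp add: t_def)
    ultimately have "(v * G u - u * G v) / (v - u) \<le> G 0"
      unfolding t1 by (simp add: t_def diff_divide_distrib)
    then have "v * G u - u * G v \<le> G 0 * (v - u)" using uv by (simp add: pos_divide_le_eq)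
    then have "(G u - G 0) * v \<le> (G 0 - G v) * (- u)" by (simp add: algebra_simps)
    then show ?thesis using uv by (simp add: divide_le_eq le_divide_eq) (simp add: field_simps)
  qed
  let ?f = "\<lambda>u. (G u - G 0) / (- u)"
  define g where "g = (SUP u\<in>{..<0}. ?f u)"
  have bdd: "bdd_above (?f ` {..<0})"
    using slope[OF _ v0] by (intro bdd_aboveI[where M = "(G 0 - G v0) / v0"]) auto
  have up: "?f u \<le> g" if "u < 0" for u unfolding g_def using that by (intro cSUP_upper bdd) auto
  have g0: "g \<ge> 0" using up[of "-1"] anti[of "-1" 0] by simp
  have "G u \<le> G 0 - g * u" if pos: "0 < G u" for u
  proof (rule linorder_cases[of u 0])
    assume u: "u < 0"
    then have "G u - G 0 \<le> g * (- u)" using up[OF u] pos_divide_le_eq[of "- u" "G u - G 0" g] by simp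
    then show ?thesis by simp
  next
    assume u: "u > 0"
    have "g \<le> (G 0 - G u) / u" unfolding g_def
    proof (rule cSUP_least)
      have "-1 \<in> {..<0::real}" by simp
      then show "{..<0::real} \<noteq> {}" by blast
    qed (use slope u pos in auto)
    then show ?thesis using u by (simp add: pos_le_divide_eq)
  qed simp
  with g0 show thesis by (rule that)
qed

text \<open>
  A converse of Chernoff's inequality at the threshold \<open>0\<close>, with loss \<open>e * sqrt n\<close>. The extremal tail is
  \<open>(g * (a - u)) ^ n\<close> for \<open>u \<le> a\<close>, given by the tangent at \<open>0\<close> and meeting the axis at \<open>a\<close>; for it, \<open>s = n / a\<close>
  is the optimal exponent.
\<close>

lemma (in prob_space) exp_moment_le_tail:
  fixes n :: nat
  assumes n: "n \<ge> 1" and Y [measurable]: "Y \<in> borel_measurable M"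
  defines "F \<equiv> \<lambda>u. prob {p\<in>space M. u \<le> Y p}"
  assumes conc: "\<And>u v t. 0 < F u \<Longrightarrow> 0 < F v \<Longrightarrow> 0 < t \<Longrightarrow> t < 1 \<Longrightarrow>
       (1 - t) * root n (F u) + t * root n (F v) \<le> root n (F ((1 - t) * u + t * v))"
    and v0: "v0 > 0" "F v0 > 0" and R: "F R = 1"
  shows "\<exists>s\<ge>0. (\<integral>\<^sup>+p. ennreal (exp (s * Y p)) \<partial>M) \<le> ennreal (exp 1 * sqrt n * F 0)"
proof -
  have anti: "F v \<le> F u" if "u \<le> v" for u v
    unfolding F_def using that by (intro finite_measure_mono) auto
  have F0: "F 0 > 0" using anti[of 0 v0] v0 by linarith
  have F1: "F u \<le> 1" for u unfolding F_def by simp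
  have Fnn: "F u \<ge> 0" for u unfolding F_def by simp
  have n0: "0 < n" using n by simp
  obtain g where g: "g \<ge> 0" "\<And>u. 0 < root n (F u) \<Longrightarrow> root n (F u) \<le> root n (F 0) - g * u"
    using concave_tail_tangent[of "\<lambda>u. root n (F u)" v0] anti conc v0 n0 by auto
  show ?thesis
  proof (cases "g = 0")
    case True
    \<comment> \<open>A horizontal tangent means that the whole mass lies in the half-line, and \<open>s = 0\<close> serves.\<close>
    have "root n (F R) \<le> root n (F 0)" using g(2)[of R] R n0 True by simp
    then have "F 0 = 1" using R n0 F1[of 0] by simp
    have "1 \<le> exp 1 * sqrt (real n)"
      using n mult_mono[of 1 "exp 1" 1 "sqrt (real n)"] by simp
    then have "(1::ennreal) \<le> ennreal (exp 1 * sqrt n * F 0)" using \<open>F 0 = 1\<close> by simp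
    then show ?thesis by (intro exI[of _ 0]) (simp add: emeasure_space_1)
  next
    case False
    then have gp: "g > 0" using g by simp
    define a where "a = root n (F 0) / g"
    have a: "a > 0" using F0 n0 gp by (simp add: a_def)
    have ga: "g * a = root n (F 0)" using gp by (simp add: a_def)
    define s where "s = n / a"
    have s: "s > 0" using n a by (simp add: s_def)
    have bound: "F u \<le> (g * (a - u)) ^ n \<and> u \<le> a" if "F u > 0" for u
    proof -
      have p: "root n (F u) > 0" using that n0 by simp
      have le: "root n (F u) \<le> g * (a - u)" using g(2)[OF p] ga by (simp add: right_diff_distrib)
      then have "0 < g * (a - u)" using p by linarith
      then have "u \<le> a" using gp by (simp add: zero_less_mult_iff)
      moreover have "root n (F u) ^ n \<le> (g * (a - u)) ^ n" using p le by (intro power_mono) auto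
      ultimately show ?thesis using n0 that by simp
    qed
    have "(\<integral>\<^sup>+p. ennreal (exp (s * Y p)) \<partial>M) = (\<integral>\<^sup>+u. ennreal (s * exp (s * u)) * ennreal (F u) \<partial>lborel)"
      unfolding nn_integral_exp_eq_tail[OF Y s] F_def by (simp add: emeasure_eq_measure)
    also have "\<dots> \<le> (\<integral>\<^sup>+u. ennreal (s * exp (s * u) * (g * (a - u)) ^ n) * indicator {..a} u \<partial>lborel)"
    proof (rule nn_integral_mono)
      fix u
      show "ennreal (s * exp (s * u)) * ennreal (F u) \<le> ennreal (s * exp (s * u) * (g * (a - u)) ^ n) * indicator {..a} u"
      proof (cases "F u > 0")
        case True
        then show ?thesis using bound[OF True] s Fnn[of u]
          by (simp add: indicator_def mult_left_mono flip: ennreal_mult)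
      next
        case False
        then have "F u = 0" using Fnn[of u] by simp
        then show ?thesis by simp
      qed
    qed
    also have "\<dots> = ennreal (exp (s * a) * (g / s) ^ n * fact n)"
      by (rule nn_integral_power_exp_to[OF s g(1)])
    also have "\<dots> \<le> ennreal (exp 1 * sqrt n * F 0)"
    proof (rule ennreal_leI)
      have "g / s = root n (F 0) / n" using ga a n by (simp add: s_def)
      then have gs: "(g / s) ^ n = F 0 / real n ^ n" using n0 F0 by (simp add: power_divide)
      have "exp (s * a) = exp (real n)" using a by (simp add: s_def)
      then have "exp (s * a) * (g / s) ^ n * fact n = (fact n * exp (real n)) * (F 0 / real n ^ n)"
        by (simp add: gs)
      also have "\<dots> \<le> (exp 1 * sqrt (real n) * real n ^ n) * (F 0 / real n ^ n)"
        using fact_le_Stirling[OF n] F0 by (intro mult_right_mono) auto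
      also have "\<dots> = exp 1 * sqrt n * F 0" using n by simp
      finally show "exp (s * a) * (g / s) ^ n * fact n \<le> exp 1 * sqrt n * F 0" .
    qed
    finally show ?thesis using s by (intro exI[of _ s]) simp
  qed
qed

section \<open>Half-spaces through an interior point of a convex body\<close>

text \<open>
  A compact set is closed, and its cylinder over all of \<open>nat \<Rightarrow> real\<close> is then closed and Borel;
  there the product \<open>\<sigma>\<close>-algebra and the Borel \<open>\<sigma>\<close>-algebra coincide. The set is recovered as the
  preimage of the cylinder under extension by \<open>0\<close>.
\<close>

lemma compactin_Rn_measurable:
  assumes "compactin (Rn n) K"
  shows "K \<in> sets (lborel_Rn n)"
proof -
  have cl: "closedin (Rn n) K"
    by (intro compactin_imp_closedin assms) (simp add: Hausdorff_space_product_topology)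
  have sub: "K \<subseteq> topspace (Rn n)" using assms by (rule compactin_subset_topspace)
  let ?r = "\<lambda>y::nat \<Rightarrow> real. restrict y {..<n}"
  have "continuous_map (product_topology (\<lambda>_. euclidean) UNIV) (Rn n) ?r"
    unfolding continuous_map_componentwise
    by (auto intro: continuous_map_product_projection)
  from closedin_continuous_map_preimage[OF this cl]
  have "closed {y. ?r y \<in> K}" by (simp add: euclidean_product_topology)
  then have K': "{y. ?r y \<in> K} \<in> sets (PiM UNIV (\<lambda>_::nat. borel :: real measure))"
    unfolding sets_PiM_equal_borel by (rule borel_closed)
  let ?e = "\<lambda>y i. if i < n then y i else (0::real)"
  have "?e \<in> measurable (lborel_Rn n) (PiM UNIV (\<lambda>_::nat. borel :: real measure))"
  proof (rule measurable_PiM_single')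
    fix i :: nat
    show "(\<lambda>y. ?e y i) \<in> borel_measurable (lborel_Rn n)"
      using measurable_component_singleton[of i "{..<n}" "\<lambda>_. lborel :: real measure"]
      by (cases "i < n") auto
  qed simp
  from measurable_sets[OF this K']
  have "?e -` {y. ?r y \<in> K} \<inter> space (lborel_Rn n) \<in> sets (lborel_Rn n)" .
  moreover have "?r (?e y) = y" if "y \<in> space (lborel_Rn n)" for y
    using that by (auto simp: space_PiM PiE_iff extensional_def fun_eq_iff)
  then have "?e -` {y. ?r y \<in> K} \<inter> space (lborel_Rn n) = K"
    using sub by (auto simp: space_PiM)
  ultimately show ?thesis by simp
qed

lemma compactin_Rn_in_cube:
  assumes "compactin (Rn n) K"
  obtains R where "K \<subseteq> cube n R"
proof -
  have sub: "K \<subseteq> topspace (Rn n)" using assms by (rule compactin_subset_topspace)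
  have "\<exists>B. \<forall>y\<in>K. \<bar>y i\<bar> \<le> B" if "i < n" for i
  proof -
    have "compactin euclideanreal ((\<lambda>y. y i) ` K)"
      by (rule image_compactin[OF assms]) (use that in \<open>auto intro: continuous_map_product_projection\<close>)
    then have "bounded ((\<lambda>y. y i) ` K)" by (simp add: compactin_euclidean_iff compact_imp_bounded)
    then show ?thesis by (auto simp: bounded_iff)
  qed
  then obtain B where B: "\<And>i y. i < n \<Longrightarrow> y \<in> K \<Longrightarrow> \<bar>y i\<bar> \<le> B i" by metis
  have "\<bar>y i\<bar> \<le> (\<Sum>i<n. \<bar>B i\<bar>)" if "i < n" "y \<in> K" for i y
  proof -
    have "\<bar>y i\<bar> \<le> \<bar>B i\<bar>" using B[OF that] by linarith
    also have "\<dots> \<le> (\<Sum>i<n. \<bar>B i\<bar>)" using that by (intro member_le_sum) auto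
    finally show ?thesis .
  qed
  then have "K \<subseteq> cube n (\<Sum>i<n. \<bar>B i\<bar>)"
    using sub by (fastforce simp: cube_def PiE_iff abs_le_iff)
  then show thesis by (rule that)
qed

lemma interior_of_Rn_box:
  assumes "x \<in> Rn n interior_of K"
  obtains e where "e > 0" "\<And>y. y \<in> topspace (Rn n) \<Longrightarrow> (\<And>i. i < n \<Longrightarrow> \<bar>y i - x i\<bar> < e) \<Longrightarrow> y \<in> K"
proof -
  obtain U where U: "openin (Rn n) U" "x \<in> U" "U \<subseteq> K" using assms by (auto simp: interior_of_def)
  obtain X where X: "x \<in> Pi\<^sub>E {..<n} X" "\<And>i. open (X i)" "Pi\<^sub>E {..<n} X \<subseteq> U"
    using product_topology_open_contains_basis[OF U(1,2)] by auto
  have "\<exists>e>0. ball (x i) e \<subseteq> X i" if "i < n" for i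
    using X(1,2) that by (auto simp: PiE_iff open_contains_ball)
  then obtain e where e: "\<And>i. i < n \<Longrightarrow> e i > 0" "\<And>i. i < n \<Longrightarrow> ball (x i) (e i) \<subseteq> X i" by metis
  define d where "d = Min (insert 1 (e ` {..<n}))"
  have d: "d > 0" unfolding d_def using e(1) by (subst Min_gr_iff) auto
  have de: "d \<le> e i" if "i < n" for i unfolding d_def using that by (intro Min_le) auto
  have "y \<in> K" if y: "y \<in> topspace (Rn n)" "\<And>i. i < n \<Longrightarrow> \<bar>y i - x i\<bar> < d" for y
  proof -
    have "y i \<in> X i" if "i < n" for i
      using e(2)[OF that] y(2)[OF that] de[OF that] by (auto simp: subset_iff dist_real_def abs_minus_commute)
    then have "y \<in> Pi\<^sub>E {..<n} X" using y(1) by (auto simp: PiE_iff)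
    then show ?thesis using X U by auto
  qed
  with d show thesis by (rule that)
qed

lemma emeasure_open_box:
  assumes "e > 0"
  shows "emeasure (lborel_Rn n) (\<Pi>\<^sub>E i\<in>{..<n}. {c i - e<..<c i + e}) = ennreal ((2 * e) ^ n)"
  using assms by (subst lborel_family.emeasure_PiM) (auto simp: ennreal_power)

lemma convex_body_emeasure:
  assumes "convex_body n K"
  shows "K \<in> sets (lborel_Rn n)" "emeasure (lborel_Rn n) K \<noteq> 0" "emeasure (lborel_Rn n) K \<noteq> \<infinity>"
proof -
  have K: "compactin (Rn n) K" "Rn n interior_of K \<noteq> {}" using assms by (auto simp: convex_body_def)
  show m: "K \<in> sets (lborel_Rn n)" by (rule compactin_Rn_measurable[OF K(1)])
  obtain x where x: "x \<in> Rn n interior_of K" using K(2) by blast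
  obtain e where e: "e > 0" "\<And>y. y \<in> topspace (Rn n) \<Longrightarrow> (\<And>i. i < n \<Longrightarrow> \<bar>y i - x i\<bar> < e) \<Longrightarrow> y \<in> K"
    using interior_of_Rn_box[OF x] by metis
  have "(\<Pi>\<^sub>E i\<in>{..<n}. {x i - e<..<x i + e}) \<subseteq> K"
  proof
    fix y assume y: "y \<in> (\<Pi>\<^sub>E i\<in>{..<n}. {x i - e<..<x i + e})"
    then have "\<bar>y i - x i\<bar> < e" if "i < n" for i using PiE_mem[OF y, of i] that by (auto simp: abs_less_iff)
    then show "y \<in> K" using y by (intro e(2)) (auto simp: PiE_iff)
  qed
  then have "ennreal ((2 * e) ^ n) \<le> emeasure (lborel_Rn n) K"
    using emeasure_mono[OF _ m] emeasure_open_box[OF e(1)] by metis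
  moreover have "(2 * e) ^ n > 0" using e(1) by simp
  then have "0 < ennreal ((2 * e) ^ n)" by (simp only: ennreal_less_zero_iff)
  ultimately show "emeasure (lborel_Rn n) K \<noteq> 0" by (metis leD)
  obtain R where "K \<subseteq> cube n R" using compactin_Rn_in_cube[OF K(1)] .
  from emeasure_finite_in_cube(1)[OF this] show "emeasure (lborel_Rn n) K \<noteq> \<infinity>" by simp
qed

lemma affine_functional_measurable:
  "(\<lambda>p. \<Sum>j<n. \<theta> j * (p j - x j)) \<in> borel_measurable (lborel_Rn n)"
proof -
  have "(\<lambda>p. p j) \<in> borel_measurable (lborel_Rn n)" if "j < n" for j
    using that measurable_component_singleton[of j "{..<n}" "\<lambda>_. lborel :: real measure"] by simp
  then show ?thesis by measurable
qed

text \<open>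
  By convexity of \<open>K\<close>, convex combinations of points of the caps at heights \<open>u\<close> and \<open>v\<close> lie in the cap at
  the corresponding convex combination of \<open>u\<close> and \<open>v\<close>, so the Brunn--Minkowski inequality applies.
\<close>

lemma convex_body_tail_concave:
  fixes \<theta> x :: "nat \<Rightarrow> real"
  assumes n: "n \<ge> 1" and K: "convex_body n K"
  defines "F \<equiv> \<lambda>u. measure (lborel_Rn n) {p\<in>K. u \<le> (\<Sum>j<n. \<theta> j * (p j - x j))}"
  assumes F: "0 < F u" "0 < F v" and t: "0 < t" "t < 1"
  shows "(1 - t) * root n (F u) + t * root n (F v) \<le> root n (F ((1 - t) * u + t * v))"
proof -
  define A where "A u = {p\<in>K. u \<le> (\<Sum>j<n. \<theta> j * (p j - x j))}" for u
  have F_A: "F u = measure (lborel_Rn n) (A u)" for u by (simp add: F_def A_def)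
  have n0: "0 < n" using n by simp
  have Km: "K \<in> sets (lborel_Rn n)" by (rule convex_body_emeasure(1)[OF K])
  have [measurable]: "A u \<in> sets (lborel_Rn n)" for u
  proof -
    have "A u = K \<inter> {p\<in>space (lborel_Rn n). u \<le> (\<Sum>j<n. \<theta> j * (p j - x j))}"
      using sets.sets_into_space[OF Km] by (auto simp: A_def)
    moreover have "{p\<in>space (lborel_Rn n). u \<le> (\<Sum>j<n. \<theta> j * (p j - x j))} \<in> sets (lborel_Rn n)"
      using affine_functional_measurable[of \<theta> x n] by measurable
    ultimately show ?thesis using Km by auto
  qed
  have comp: "compactin (Rn n) K" and conv: "convex_Rn n K" using K by (auto simp: convex_body_def)
  obtain R where R: "K \<subseteq> cube n R" using compactin_Rn_in_cube[OF comp] .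
  then have AR: "A u \<subseteq> cube n R" for u by (auto simp: A_def)
  have AF: "emeasure (lborel_Rn n) (A u) = ennreal (F u)" for u
    unfolding F_A by (rule emeasure_finite_in_cube(1)[OF AR])
  have "ennreal (((1 - t) * root n (F u) + t * root n (F v)) ^ n)
    \<le> emeasure (lborel_Rn n) (A ((1 - t) * u + t * v))"
  proof (rule brunn_minkowski[where A = "A u" and B = "A v" and R = R])
    fix p q assume p: "p \<in> A u" and q: "q \<in> A v"
    let ?r = "\<lambda>i\<in>{..<n}. (1 - t) * p i + t * q i"
    have "?r \<in> K" using p q t by (intro convex_RnD[OF conv]) (auto simp: A_def)
    moreover have "(1 - t) * u + t * v \<le> (1 - t) * (\<Sum>j<n. \<theta> j * (p j - x j)) + t * (\<Sum>j<n. \<theta> j * (q j - x j))"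
      using p q t by (intro add_mono mult_left_mono) (auto simp: A_def)
    moreover have "\<dots> = (\<Sum>j<n. \<theta> j * (?r j - x j))"
      unfolding sum_distrib_left sum.distrib[symmetric]
      by (intro sum.cong) (auto simp: algebra_simps)
    ultimately show "?r \<in> A ((1 - t) * u + t * v)" by (simp add: A_def)
  qed (use F t n0 AR AF in auto)
  then have "((1 - t) * root n (F u) + t * root n (F v)) ^ n \<le> F ((1 - t) * u + t * v)"
    unfolding AF by (subst (asm) ennreal_le_iff) (auto simp: F_def)
  then have "root n (((1 - t) * root n (F u) + t * root n (F v)) ^ n) \<le> root n (F ((1 - t) * u + t * v))"
    using n0 by simp
  moreover have "0 \<le> (1 - t) * root n (F u) + t * root n (F v)" using F t n0 by simp
  ultimately show ?thesis using n0 by (simp add: real_root_power_cancel)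
qed

text \<open>
  A small box around the point \<open>x + d \<theta>\<close> lies in \<open>K\<close> and strictly inside the half-space.
  Thus the tail is positive beyond \<open>0\<close>, which makes the slope of its tangent at \<open>0\<close> finite.
\<close>

lemma exists_positive_tail:
  assumes x: "x \<in> Rn n interior_of K" and K: "K \<in> sets (lborel_Rn n)" "emeasure (lborel_Rn n) K \<noteq> \<infinity>"
    and \<theta>: "\<exists>j<n. \<theta> j \<noteq> 0"
  obtains v where "v > 0" "0 < measure (lborel_Rn n) {p\<in>K. v \<le> (\<Sum>j<n. \<theta> j * (p j - x j))}"
proof -
  obtain e where e: "e > 0" "\<And>y. y \<in> topspace (Rn n) \<Longrightarrow> (\<And>i. i < n \<Longrightarrow> \<bar>y i - x i\<bar> < e) \<Longrightarrow> y \<in> K"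
    using interior_of_Rn_box[OF x] by metis
  define S where "S = 1 + (\<Sum>j<n. \<bar>\<theta> j\<bar>)"
  define T where "T = (\<Sum>j<n. (\<theta> j)\<^sup>2)"
  have Spos: "S > 0" unfolding S_def by (simp add: add_pos_nonneg sum_nonneg)
  have thS: "\<bar>\<theta> j\<bar> \<le> S" if "j < n" for j
    using member_le_sum[of j "{..<n}" "\<lambda>j. \<bar>\<theta> j\<bar>"] that by (simp add: S_def)
  have Tpos: "T > 0" unfolding T_def using \<theta> by (auto intro!: sum_pos2)
  define d where "d = e / (2 * S)"
  have d: "d > 0" using e Spos by (simp add: d_def)
  define h where "h = min (e / 2) (d * T / (2 * S))"
  have h: "h > 0" "h \<le> e / 2" "h \<le> d * T / (2 * S)" using e d Tpos Spos by (auto simp: h_def)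
  define c where "c i = x i + d * \<theta> i" for i
  define B where "B = (\<Pi>\<^sub>E i\<in>{..<n}. {c i - h<..<c i + h})"
  define v where "v = d * T / 2"
  have v: "v > 0" using d Tpos by (simp add: v_def)
  have sub: "B \<subseteq> {p\<in>K. v \<le> (\<Sum>j<n. \<theta> j * (p j - x j))}"
  proof
    fix p assume p: "p \<in> B"
    have pc': "\<bar>p i - c i\<bar> < h" if "i < n" for i
      using PiE_mem[OF p[unfolded B_def], of i] that by (auto simp: abs_less_iff)
    then have pc: "\<bar>p i - c i\<bar> \<le> h" if "i < n" for i using that by (auto intro: less_imp_le)
    have "\<bar>p i - x i\<bar> < e" if "i < n" for i
    proof -
      have "d * \<bar>\<theta> i\<bar> \<le> d * S" using thS[OF that] d by simp
      also have "\<dots> = e / 2" using Spos by (simp add: d_def)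
      finally have "\<bar>c i - x i\<bar> \<le> e / 2" using d by (simp add: c_def abs_mult)
      then show ?thesis using pc'[OF that] h by linarith
    qed
    then have "p \<in> K" using p by (intro e(2)) (auto simp: B_def PiE_iff)
    moreover have "v \<le> (\<Sum>j<n. \<theta> j * (p j - x j))"
    proof -
      have "\<bar>\<Sum>j<n. \<theta> j * (p j - c j)\<bar> \<le> (\<Sum>j<n. \<bar>\<theta> j\<bar> * h)"
        by (rule order_trans[OF sum_abs sum_mono]) (auto simp: abs_mult intro!: mult_left_mono pc)
      also have "\<dots> = (S - 1) * h" by (simp add: S_def sum_distrib_right)
      also have "\<dots> \<le> S * (d * T / (2 * S))" using h Spos by (intro mult_mono) auto
      also have "\<dots> = v" using Spos by (simp add: v_def)
      finally have "- v \<le> (\<Sum>j<n. \<theta> j * (p j - c j))" by linarith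
      moreover have "(\<Sum>j<n. \<theta> j * (p j - x j)) = (\<Sum>j<n. \<theta> j * (p j - c j)) + d * T"
        unfolding T_def sum_distrib_left sum.distrib[symmetric]
        by (intro sum.cong) (auto simp: c_def algebra_simps power2_eq_square)
      ultimately show ?thesis unfolding v_def by linarith
    qed
    ultimately show "p \<in> {p\<in>K. v \<le> (\<Sum>j<n. \<theta> j * (p j - x j))}" by simp
  qed
  have Hs: "{p\<in>K. v \<le> (\<Sum>j<n. \<theta> j * (p j - x j))} \<in> sets (lborel_Rn n)" (is "?H \<in> _")
  proof -
    have "?H = K \<inter> {p\<in>space (lborel_Rn n). v \<le> (\<Sum>j<n. \<theta> j * (p j - x j))}"
      using sets.sets_into_space[OF K(1)] by auto
    moreover have "{p\<in>space (lborel_Rn n). v \<le> (\<Sum>j<n. \<theta> j * (p j - x j))} \<in> sets (lborel_Rn n)"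
      using affine_functional_measurable[of \<theta> x n] by measurable
    ultimately show ?thesis using K(1) by auto
  qed
  have "ennreal ((2 * h) ^ n) \<le> emeasure (lborel_Rn n) ?H"
    using emeasure_mono[OF sub Hs] emeasure_open_box[OF h(1)] unfolding B_def by metis
  moreover have "emeasure (lborel_Rn n) ?H \<le> emeasure (lborel_Rn n) K"
    by (rule emeasure_mono) (use K in auto)
  then have "emeasure (lborel_Rn n) ?H = ennreal (measure (lborel_Rn n) ?H)"
    using K(2) by (intro emeasure_eq_ennreal_measure) (auto simp: top_unique)
  ultimately have "ennreal ((2 * h) ^ n) \<le> ennreal (measure (lborel_Rn n) ?H)" by (simp only:)
  then have "(2 * h) ^ n \<le> measure (lborel_Rn n) ?H" by (subst (asm) ennreal_le_iff) auto
  moreover have "(2 * h) ^ n > 0" using h by simp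
  ultimately have "0 < measure (lborel_Rn n) ?H" by linarith
  with v show thesis by (rule that)
qed

text \<open>
  The chord condition on the \<open>n\<close>-th root of the tail holds for Lebesgue measure and is homogeneous, so
  it passes to the uniform measure.
\<close>

lemma convex_body_halfspace:
  assumes n: "n \<ge> 1" and K: "convex_body n K" and x: "x \<in> Rn n interior_of K"
  shows "\<exists>s\<ge>0. (\<integral>\<^sup>+p. ennreal (exp (s * (\<Sum>j<n. \<theta> j * (p j - x j)))) \<partial>unif n K)
    \<le> ennreal (exp 1 * sqrt n) * emeasure (unif n K) {p\<in>space (unif n K). 0 \<le> (\<Sum>j<n. \<theta> j * (p j - x j))}"
proof -
  note Ke = convex_body_emeasure[OF K]
  interpret prob_space "unif n K"
    unfolding unif_def by (rule prob_space_uniform_measure[OF Ke(2,3)])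
  let ?Y = "\<lambda>p. \<Sum>j<n. \<theta> j * (p j - x j)"
  have n1: "1 \<le> exp 1 * sqrt (real n)"
    using n mult_mono[of 1 "exp 1" 1 "sqrt (real n)"] by simp
  show ?thesis
  proof (cases "\<exists>j<n. \<theta> j \<noteq> 0")
    case False
    then have "?Y p = 0" for p by simp
    then show ?thesis using n1 by (intro exI[of _ 0]) (simp add: emeasure_space_1)
  next
    case True
    have [measurable]: "?Y \<in> borel_measurable (unif n K)"
      using affine_functional_measurable[of \<theta> x n] by (simp add: unif_def)
    define L where "L = measure (lborel_Rn n) K"
    define F where "F u = measure (lborel_Rn n) {p\<in>K. u \<le> ?Y p}" for u
    have Lpos: "L > 0"
      using Ke(2,3) unfolding L_def measure_def by (simp add: enn2real_positive_iff top.not_eq_extremum zero_less_iff_neq_zero)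
    have prob_F: "prob {p\<in>space (unif n K). u \<le> ?Y p} = F u / L" for u
    proof -
      have sp: "space (unif n K) = space (lborel_Rn n)" by (simp add: unif_def)
      have "{p\<in>space (lborel_Rn n). u \<le> ?Y p} \<in> sets (lborel_Rn n)"
        using affine_functional_measurable[of \<theta> x n] by measurable
      moreover have "K \<inter> {p\<in>space (lborel_Rn n). u \<le> ?Y p} = {p\<in>K. u \<le> ?Y p}"
        using sets.sets_into_space[OF Ke(1)] by auto
      ultimately show ?thesis
        unfolding sp unfolding unif_def F_def L_def using Ke by (simp add: measure_uniform_measure)
    qed
    obtain v0 where v0: "v0 > 0" "F v0 > 0"
      by (rule exists_positive_tail[OF x Ke(1,3) True]) (rule that, simp_all add: F_def)
    have "compactin (Rn n) K" using K by (simp add: convex_body_def)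
    then obtain R where R: "K \<subseteq> cube n R" by (rule compactin_Rn_in_cube)
    \<comment> \<open>Below \<open>R'\<close> the functional takes no values on the bounded set \<open>K\<close>.\<close>
    define R' where "R' = - (\<Sum>j<n. \<bar>\<theta> j\<bar> * (\<bar>R\<bar> + \<bar>x j\<bar>))"
    have "R' \<le> ?Y p" if "p \<in> K" for p
    proof -
      have "\<bar>p j - x j\<bar> \<le> \<bar>R\<bar> + \<bar>x j\<bar>" if "j < n" for j
      proof -
        have "p j \<in> {-R..R}" using \<open>p \<in> K\<close> R that by (auto simp: cube_def PiE_iff)
        then show ?thesis by auto
      qed
      then have "\<bar>?Y p\<bar> \<le> (\<Sum>j<n. \<bar>\<theta> j\<bar> * (\<bar>R\<bar> + \<bar>x j\<bar>))"
        by (intro order_trans[OF sum_abs sum_mono]) (auto simp: abs_mult intro!: mult_left_mono)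
      then show ?thesis by (simp add: R'_def)
    qed
    then have "{p\<in>K. R' \<le> ?Y p} = K" by auto
    then have FR: "F R' / L = 1" using Lpos by (simp add: F_def L_def)
    have "\<exists>s\<ge>0. (\<integral>\<^sup>+p. ennreal (exp (s * ?Y p)) \<partial>unif n K) \<le> ennreal (exp 1 * sqrt n * prob {p\<in>space (unif n K). 0 \<le> ?Y p})"
    proof (rule exp_moment_le_tail[OF n, of _ v0 R'])
      fix u v t assume "0 < prob {p\<in>space (unif n K). u \<le> ?Y p}" "0 < prob {p\<in>space (unif n K). v \<le> ?Y p}"
        and t: "0 < t" "t < (1::real)"
      then have "0 < F u" "0 < F v" using Lpos by (auto simp: prob_F zero_less_divide_iff)
      from convex_body_tail_concave[OF n K this[unfolded F_def] t]
      have "((1 - t) * root n (F u) + t * root n (F v)) / root n L \<le> root n (F ((1 - t) * u + t * v)) / root n L"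
        unfolding F_def using Lpos n by (intro divide_right_mono) auto
      then show "(1 - t) * root n (prob {p\<in>space (unif n K). u \<le> ?Y p}) + t * root n (prob {p\<in>space (unif n K). v \<le> ?Y p})
        \<le> root n (prob {p\<in>space (unif n K). (1 - t) * u + t * v \<le> ?Y p})"
        unfolding prob_F by (simp add: real_root_divide add_divide_distrib)
    qed (use v0 FR Lpos in \<open>simp_all add: prob_F\<close>)
    then show ?thesis by (simp add: emeasure_eq_measure ennreal_mult)
  qed
qed

section \<open>Comparison with the Cramer transform\<close>

lemma inner_Rn_measurable:
  assumes "sets M = sets (lborel_Rn n)"
  shows "inner_Rn n \<theta> \<in> borel_measurable M"
  using affine_functional_measurable[of \<theta> "\<lambda>_. 0" n] unfolding measurable_cong_sets[OF assms refl] inner_Rn_def[abs_def]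
  by simp

lemma laplace_scaled:
  assumes M: "sets M = sets (lborel_Rn n)"
  shows "(\<integral>\<^sup>+p. ennreal (exp (inner_Rn n \<theta> p - t)) \<partial>M)
    = ennreal (exp (- t)) * (\<integral>\<^sup>+p. ennreal (exp (inner_Rn n \<theta> p)) \<partial>M)"
proof -
  have [measurable]: "inner_Rn n \<theta> \<in> borel_measurable M" by (rule inner_Rn_measurable[OF M])
  show ?thesis
    by (subst nn_integral_cmult[symmetric]) (simp_all add: exp_diff exp_minus divide_inverse mult.commute flip: ennreal_mult)
qed

lemma laplace_pos:
  assumes "prob_space M" and M: "sets M = sets (lborel_Rn n)"
  shows "0 < (\<integral>\<^sup>+p. ennreal (exp (inner_Rn n \<theta> p)) \<partial>M)"
proof (rule ccontr)
  interpret prob_space M by fact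
  have [measurable]: "inner_Rn n \<theta> \<in> borel_measurable M" by (rule inner_Rn_measurable[OF M])
  assume "\<not> ?thesis"
  then have "(\<integral>\<^sup>+p. ennreal (exp (inner_Rn n \<theta> p)) \<partial>M) = 0" by simp
  then have "AE p in M. ennreal (exp (inner_Rn n \<theta> p)) = 0"
    by (subst (asm) nn_integral_0_iff_AE) auto
  then have "AE p in M. False" by simp
  then show False by simp
qed

text \<open>
  The form in which the Cramer transform enters the upper bound: every exponential moment of
  \<open>p - x\<close> is at least \<open>exp (- \<Lambda>\<^sup>* x)\<close>.
\<close>

lemma cramer_le_moment:
  assumes prob: "prob_space M" and M: "sets M = sets (lborel_Rn n)"
    and \<theta>: "\<theta> \<in> topspace (Rn n)" and r: "cramer n M x = ereal r"
  shows "ennreal (exp (- r)) \<le> (\<integral>\<^sup>+p. ennreal (exp (inner_Rn n \<theta> p - inner_Rn n \<theta> x)) \<partial>M)"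
proof -
  define I where "I = (\<integral>\<^sup>+p. ennreal (exp (inner_Rn n \<theta> p)) \<partial>M)"
  let ?t = "inner_Rn n \<theta> x"
  have Ipos: "I > 0" unfolding I_def by (rule laplace_pos[OF prob M])
  have le: "ereal ?t - log_laplace n M \<theta> \<le> ereal r"
    unfolding r[symmetric] cramer_def by (rule SUP_upper[OF \<theta>])
  show ?thesis
    unfolding laplace_scaled[OF M] I_def[symmetric]
  proof (cases I)
    case (real c)
    then have c: "c > 0" using Ipos by simp
    have "log_laplace n M \<theta> = ereal (ln c)"
      using real c by (simp add: log_laplace_def I_def[symmetric])
    then have "- r \<le> - ?t + ln c" using le by simp
    then have "exp (- r) \<le> exp (- ?t + ln c)" by simp
    moreover have "exp (- ?t + ln c) = exp (- ?t) * c" using c by (simp only: exp_add exp_ln)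
    ultimately have "exp (- r) \<le> exp (- ?t) * c" by (simp only:)
    then show "ennreal (exp (- r)) \<le> ennreal (exp (- ?t)) * I"
      using real c by (simp add: ennreal_leI flip: ennreal_mult)
  qed (simp add: ennreal_mult_top)
qed

lemma cramer_nonneg:
  assumes "prob_space M"
  shows "0 \<le> cramer n M x"
proof -
  interpret prob_space M by fact
  let ?z = "\<lambda>i\<in>{..<n}. 0::real"
  have "inner_Rn n ?z p = 0" for p by (simp add: inner_Rn_def)
  then have "ereal (inner_Rn n ?z x) - log_laplace n M ?z = 0"
    by (simp add: log_laplace_def emeasure_space_1)
  moreover have "?z \<in> topspace (Rn n)" by simp
  from SUP_upper[OF this, of "\<lambda>\<theta>. ereal (inner_Rn n \<theta> x) - log_laplace n M \<theta>"]
  have "ereal (inner_Rn n ?z x) - log_laplace n M ?z \<le> cramer n M x" unfolding cramer_def .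
  ultimately show ?thesis by (simp only:)
qed

lemma exp_ereal_le:
  assumes "a \<le> ereal (ln c)" "c > 0"
  shows "exp_ereal a \<le> ereal c"
proof (cases a)
  case (real r)
  then have "r \<le> ln c" using assms by simp
  then have "exp r \<le> c" using assms(2) by (simp add: ln_ge_iff)
  then show ?thesis using real by (simp add: exp_ereal_def)
qed (use assms in \<open>auto simp: exp_ereal_def\<close>)

text \<open>
  If \<open>\<langle>\<theta>, \<cdot>\<rangle>\<close> were smaller than at \<open>x\<close> at all sample points, it would be so at every convex
  combination of them, in particular at \<open>x\<close> itself.
\<close>

lemma prob_in_hull_le:
  assumes prob: "prob_space M" and M: "sets M = sets (lborel_Rn n)"
  shows "measure (PiM UNIV (\<lambda>_::nat. M)) {y \<in> space (PiM UNIV (\<lambda>_. M)). x \<in> convex_Rn n hull (y ` {..<N})}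
    \<le> real N * measure M {p\<in>space M. inner_Rn n \<theta> x \<le> inner_Rn n \<theta> p}"
proof -
  interpret M: prob_space M by fact
  interpret U: product_prob_space "\<lambda>_::nat. M" UNIV by unfold_locales
  let ?U = "PiM (UNIV :: nat set) (\<lambda>_. M)"
  let ?H = "{p\<in>space M. inner_Rn n \<theta> x \<le> inner_Rn n \<theta> p}"
  have [measurable]: "inner_Rn n \<theta> \<in> borel_measurable M" by (rule inner_Rn_measurable[OF M])
  have H: "?H \<in> sets M" by measurable
  define A where "A i = {y \<in> space ?U. y i \<in> ?H}" for i
  have A: "A i \<in> sets ?U" for i
  proof -
    have "A i = (\<lambda>y. y i) -` ?H \<inter> space ?U" by (auto simp: A_def)
    moreover have "(\<lambda>y. y i) \<in> measurable ?U M" by (rule measurable_component_singleton) simp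
    from measurable_sets[OF this H] have "(\<lambda>y. y i) -` ?H \<inter> space ?U \<in> sets ?U" .
    ultimately show ?thesis by (simp only:)
  qed
  have "{y \<in> space ?U. x \<in> convex_Rn n hull (y ` {..<N})} \<subseteq> (\<Union>i<N. A i)"
  proof
    fix y assume "y \<in> {y \<in> space ?U. x \<in> convex_Rn n hull (y ` {..<N})}"
    then have y: "y \<in> space ?U" "x \<in> convex_Rn n hull (y ` {..<N})" by auto
    have sp: "y i \<in> space M" for i using y(1) by (auto simp: space_PiM)
    have spM: "space M = topspace (Rn n)" using sets_eq_imp_space_eq[OF M] by (simp add: space_PiM)
    show "y \<in> (\<Union>i<N. A i)"
    proof (rule ccontr)
      assume "y \<notin> (\<Union>i<N. A i)"
      then have lt: "inner_Rn n \<theta> (y i) < inner_Rn n \<theta> x" if "i < N" for i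
        using that y(1) sp by (auto simp: A_def not_le)
      obtain w where w: "w \<in> weights {..<N}" "x = (\<lambda>j\<in>{..<n}. \<Sum>i<N. w i * y i j)"
        using y(2) sp spM convex_Rn_hull_image[of "{..<N}" y n] by auto
      have "inner_Rn n \<theta> x = (\<Sum>i<N. w i * inner_Rn n \<theta> (y i))"
        unfolding inner_Rn_def w(2) sum_distrib_left by (subst sum.swap) (simp add: mult.left_commute sum_distrib_left)
      also have "\<dots> < (\<Sum>i<N. w i * inner_Rn n \<theta> x)"
      proof (rule sum_strict_mono_ex1)
        show "\<forall>i\<in>{..<N}. w i * inner_Rn n \<theta> (y i) \<le> w i * inner_Rn n \<theta> x"
          using w(1) less_imp_le[OF lt] by (auto simp: weights_def intro!: mult_left_mono)
        have "\<exists>i<N. w i \<noteq> 0"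
        proof (rule ccontr)
          assume "\<not> ?thesis"
          then have "sum w {..<N} = 0" by simp
          then show False using w(1) by (simp add: weights_def)
        qed
        then obtain i where i: "i < N" "w i > 0" using w(1) by (force simp: weights_def)
        then show "\<exists>i\<in>{..<N}. w i * inner_Rn n \<theta> (y i) < w i * inner_Rn n \<theta> x"
          using lt by (intro bexI[of _ i] mult_strict_left_mono) auto
      qed simp
      also have "\<dots> = inner_Rn n \<theta> x" using w(1) by (simp add: weights_def flip: sum_distrib_right)
      finally show False by simp
    qed
  qed
  then have "U.prob {y \<in> space ?U. x \<in> convex_Rn n hull (y ` {..<N})} \<le> U.prob (\<Union>i<N. A i)"
    using A by (intro U.finite_measure_mono) auto
  also have "\<dots> \<le> (\<Sum>i<N. U.prob (A i))"
    using A by (intro U.finite_measure_subadditive_finite) auto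
  also have "\<dots> = real N * M.prob ?H"
    using U.emeasure_PiM_Collect_single[OF _ H] by (simp add: A_def measure_def)
  finally show ?thesis .
qed

lemma cramer_le_ln_threshold:
  assumes prob: "prob_space M" and M: "sets M = sets (lborel_Rn n)"
    and N: "1 / 2 \<le> measure (PiM UNIV (\<lambda>_::nat. M)) {y \<in> space (PiM UNIV (\<lambda>_. M)). x \<in> convex_Rn n hull (y ` {..<N})}"
  shows "N > 0" "cramer n M x \<le> ereal (ln (2 * real N))"
proof -
  interpret M: prob_space M by fact
  have half: "1 / 2 \<le> real N * M.prob {p\<in>space M. inner_Rn n \<theta> x \<le> inner_Rn n \<theta> p}" for \<theta>
    using N prob_in_hull_le[OF prob M] by (rule order_trans)
  show N0: "N > 0" using half[of "\<lambda>_. 0"] by (cases "N = 0") auto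
  show "cramer n M x \<le> ereal (ln (2 * real N))"
    unfolding cramer_def
  proof (rule SUP_least)
    fix \<theta>
    define I where "I = (\<integral>\<^sup>+p. ennreal (exp (inner_Rn n \<theta> p)) \<partial>M)"
    let ?t = "inner_Rn n \<theta> x"
    let ?H = "{p\<in>space M. ?t \<le> inner_Rn n \<theta> p}"
    have [measurable]: "inner_Rn n \<theta> \<in> borel_measurable M" by (rule inner_Rn_measurable[OF M])
    have Ipos: "I > 0" unfolding I_def by (rule laplace_pos[OF prob M])
    show "ereal ?t - log_laplace n M \<theta> \<le> ereal (ln (2 * real N))"
    proof (cases I)
      case (real c)
      then have c: "c > 0" using Ipos by simp
      have "emeasure M ?H = (\<integral>\<^sup>+p. indicator ?H p \<partial>M)" by simp
      also have "\<dots> \<le> (\<integral>\<^sup>+p. ennreal (exp (inner_Rn n \<theta> p - ?t)) \<partial>M)"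
        by (intro nn_integral_mono) (auto simp: indicator_def)
      also have "\<dots> = ennreal (exp (- ?t) * c)"
        unfolding laplace_scaled[OF M] I_def[symmetric] real(2) using c by (simp flip: ennreal_mult)
      finally have "M.prob ?H \<le> exp (- ?t) * c"
        using c by (simp add: M.emeasure_eq_measure)
      then have "real N * M.prob ?H \<le> real N * (exp (- ?t) * c)"
        by (rule mult_left_mono) simp
      with half[of \<theta>] have "exp ?t * (1 / 2) \<le> exp ?t * (real N * (exp (- ?t) * c))"
        by (intro mult_left_mono) auto
      also have "\<dots> = real N * c * (exp ?t * exp (- ?t))" by simp
      also have "\<dots> = real N * c" by (simp flip: exp_add)
      finally have "exp ?t \<le> 2 * real N * c" by simp
      then have "?t \<le> ln (2 * real N * c)" using c N0 by (simp add: ln_ge_iff)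
      also have "\<dots> = ln (2 * real N) + ln c" using c N0 by (intro ln_mult_pos) auto
      finally have "?t - ln c \<le> ln (2 * real N)" by simp
      moreover have "log_laplace n M \<theta> = ereal (ln c)"
        using real c by (simp add: log_laplace_def I_def[symmetric])
      ultimately show ?thesis by simp
    next
      case top
      then have "log_laplace n M \<theta> = \<infinity>" by (simp add: log_laplace_def I_def[symmetric])
      then show ?thesis by simp
    qed
  qed
qed

lemma exp_cramer_le_median_threshold:
  assumes prob: "prob_space M" and M: "sets M = sets (lborel_Rn n)"
  shows "ereal (1 / 2) * exp_ereal (cramer n M x) \<le> ereal_of_enat (median_threshold n M x)"
proof (cases "median_threshold n M x")
  case (enat N)
  let ?S = "{N. \<P>(y in (\<Pi>\<^sub>M k\<in>(UNIV :: nat set). M). x \<in> convex_Rn n hull (y ` {..<N})) \<ge> 1 / 2}"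
  have "Inf (enat ` ?S) = enat N" using enat unfolding median_threshold_def .
  moreover have "enat ` ?S \<noteq> {}"
  proof
    assume "enat ` ?S = {}"
    with \<open>Inf (enat ` ?S) = enat N\<close> have "Inf {} = enat N" by (simp only:)
    then show False by (simp add: Inf_enat_def)
  qed
  then obtain k where "k \<in> enat ` ?S" by blast
  from wellorder_InfI[OF this] have "Inf (enat ` ?S) \<in> enat ` ?S" .
  ultimately have "enat N \<in> enat ` ?S" by (simp only:)
  then have "N \<in> ?S" by auto
  then have N: "1 / 2 \<le> measure (PiM UNIV (\<lambda>_::nat. M)) {y \<in> space (PiM UNIV (\<lambda>_. M)). x \<in> convex_Rn n hull (y ` {..<N})}"
    by simp
  have "exp_ereal (cramer n M x) \<le> ereal (2 * real N)"
    using cramer_le_ln_threshold[OF prob M N] by (intro exp_ereal_le) auto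
  then have "ereal (1 / 2) * exp_ereal (cramer n M x) \<le> ereal (1 / 2) * ereal (2 * real N)"
    by (intro ereal_mult_left_mono) auto
  then show ?thesis using enat by simp
qed simp

text \<open>
  With \<open>c = e * sqrt n\<close>, the depth is at least \<open>\<alpha> = exp (- r) / c\<close>. Since \<open>\<alpha> \<le> 1 \<le> n\<close>, rounding
  \<open>2 (n + 1) / \<alpha>\<close> up to an integer gives at most \<open>5 n / \<alpha>\<close>.
\<close>

lemma median_threshold_le_exp_cramer:
  assumes n: "n \<ge> 1" and K: "convex_body n K" and x: "x \<in> Rn n interior_of K"
  shows "ereal_of_enat (median_threshold n (unif n K) x)
    \<le> ereal (5 * exp 1 * real n powr (3 / 2)) * exp_ereal (cramer n (unif n K) x)"
proof -
  note Ke = convex_body_emeasure[OF K]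
  let ?M = "unif n K"
  have prob: "prob_space ?M"
    unfolding unif_def by (rule prob_space_uniform_measure[OF Ke(2,3)])
  then interpret prob_space ?M .
  have M: "sets ?M = sets (lborel_Rn n)" by (simp add: unif_def)
  have xt: "x \<in> topspace (Rn n)" using x interior_of_subset_topspace by (metis subsetD)
  have "0 \<le> cramer n ?M x" by (rule cramer_nonneg[OF prob])
  then consider r where "cramer n ?M x = ereal r" | "cramer n ?M x = \<infinity>"
    by (cases "cramer n ?M x") auto
  then show ?thesis
  proof cases
    case 2
    then show ?thesis using n by (simp add: exp_ereal_def)
  next
    case (1 r)
    define c where "c = exp 1 * sqrt (real n)"
    define \<alpha> where "\<alpha> = exp (- r) / c"
    have c: "c > 0" using n by (simp add: c_def)
    then have \<alpha>: "\<alpha> > 0" by (simp add: \<alpha>_def)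
    have depth: "ennreal \<alpha> \<le> emeasure ?M {p\<in>space ?M. 0 \<le> (\<Sum>j<n. \<theta> j * (p j - x j))}" (is "_ \<le> ?h") for \<theta>
    proof -
      obtain s where s: "s \<ge> 0"
        "(\<integral>\<^sup>+p. ennreal (exp (s * (\<Sum>j<n. \<theta> j * (p j - x j)))) \<partial>?M) \<le> ennreal c * ?h"
        using convex_body_halfspace[OF n K x, of \<theta>] unfolding c_def by blast
      define \<theta>' where "\<theta>' = (\<lambda>j\<in>{..<n}. s * \<theta> j)"
      have "s * (\<Sum>j<n. \<theta> j * (p j - x j)) = inner_Rn n \<theta>' p - inner_Rn n \<theta>' x" for p
        by (simp add: inner_Rn_def \<theta>'_def sum_distrib_left algebra_simps flip: sum_subtractf)
      moreover have "\<theta>' \<in> topspace (Rn n)" by (simp add: \<theta>'_def)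
      ultimately have "ennreal (exp (- r)) \<le> ennreal c * ?h"
        using cramer_le_moment[OF prob M _ 1, of \<theta>'] s(2) by simp
      then have "ennreal (exp (- r)) \<le> ennreal (c * measure ?M {p\<in>space ?M. 0 \<le> (\<Sum>j<n. \<theta> j * (p j - x j))})"
        using c by (simp add: emeasure_eq_measure ennreal_mult)
      then show ?thesis
        using c by (simp add: emeasure_eq_measure \<alpha>_def pos_divide_le_eq mult.commute ennreal_leI)
    qed
    have "ennreal \<alpha> \<le> 1" using depth[of "\<lambda>_. 0"] emeasure_le_1 by (rule order_trans)
    then have \<alpha>1: "\<alpha> \<le> 1" by simp
    define N where "N = nat \<lceil>2 * real (n + 1) / \<alpha>\<rceil>"
    have "median_threshold n ?M x \<le> enat N"
      unfolding N_def by (rule median_threshold_le_depth[OF prob M \<alpha> depth xt])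
    then have "ereal_of_enat (median_threshold n ?M x) \<le> ereal_of_enat (enat N)"
      by (simp only: ereal_of_enat_le_iff)
    also have "\<dots> = ereal (real N)" by simp
    also have "real N \<le> 5 * exp 1 * real n powr (3 / 2) * exp r"
    proof -
      have "0 \<le> 2 * real (n + 1) / \<alpha>" using \<alpha> by simp
      then have "real N \<le> 2 * real (n + 1) / \<alpha> + 1" unfolding N_def by linarith
      also have "\<dots> \<le> 2 * real (n + 1) / \<alpha> + 1 / \<alpha>" using \<alpha> \<alpha>1 by simp
      also have "\<dots> = (2 * real (n + 1) + 1) / \<alpha>" by (simp add: add_divide_distrib)
      also have "\<dots> \<le> (5 * real n) / \<alpha>" using \<alpha> n by (intro divide_right_mono) auto
      also have "\<dots> = 5 * exp 1 * (real n * sqrt (real n)) * exp r"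
        by (simp add: \<alpha>_def c_def exp_minus field_simps)
      also have "real n * sqrt (real n) = real n powr (3 / 2)"
        using n powr_add[of "real n" 1 "1/2"] by (simp add: powr_half_sqrt)
      finally show ?thesis .
    qed
    finally show ?thesis using 1 by (simp add: exp_ereal_def)
  qed
qed

theorem theorem1p2:
  shows "\<exists>C::real. C > 0 \<and>
    (\<forall>n\<ge>1. \<forall>K x. convex_body n K \<longrightarrow> x \<in> Rn n interior_of K \<longrightarrow>
       ereal (1 / 2) * exp_ereal (cramer n (unif n K) x)
         \<le> ereal_of_enat (median_threshold n (unif n K) x) \<and>
       ereal_of_enat (median_threshold n (unif n K) x)
         \<le> ereal (C * real n powr (3 / 2)) * exp_ereal (cramer n (unif n K) x))"
proof (intro exI[of _ "5 * exp 1"] conjI allI impI)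
  fix n K x assume n: "n \<ge> (1::nat)" and K: "convex_body n K" and x: "x \<in> Rn n interior_of K"
  note Ke = convex_body_emeasure[OF K]
  have "prob_space (unif n K)"
    unfolding unif_def by (rule prob_space_uniform_measure[OF Ke(2,3)])
  then show "ereal (1 / 2) * exp_ereal (cramer n (unif n K) x) \<le> ereal_of_enat (median_threshold n (unif n K) x)"
    by (rule exp_cramer_le_median_threshold) (simp add: unif_def)
  show "ereal_of_enat (median_threshold n (unif n K) x)
         \<le> ereal (5 * exp 1 * real n powr (3 / 2)) * exp_ereal (cramer n (unif n K) x)"
    by (rule median_threshold_le_exp_cramer[OF n K x])
qed simp

end
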